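(* Let $\alpha>0$ and $1<p,p'<\infty$ with $\frac1p+\frac1{p'}=1$. Let $\omega$ be a weight on the unit disk $\mathbb{D}$ and let $\sigma=\omega^{1-p'}$ be its dual weight. Suppose that both $\omega$ and $\sigma$ are doubling weights on $\mathbb{D}$. Then the integral operator $$(K_\alpha f)(z)=\int_{\mathbb{D}}\frac{f(\lambda)}{(1-z\overline{\lambda})^{\alpha}}\,dA(\lambda),\qquad z\in\mathbb{D},$$ is bounded on $L^p(\omega)$ if and only if $$[\omega]_{p,\alpha}:=\sup_{I\subset\mathbb{T}\text{ interval}}\frac{|Q_I|_\omega\,|Q_I|_\sigma^{\,p-1}}{|Q_I|^{\frac{p\alpha}{2}}}<\infty .$$
   Context: $\mathbb{D}$ is the open unit disk in $\mathbb{C}$, $\mathbb{T}$ is the unit circle, and $dA(z)=\frac1\pi\,dx\,dy$ is normalized area measure on $\mathbb{D}$. The power $(1-z\overline\lambda)^\alpha$ is taken with the principal branch (note $\operatorname{Re}(1-z\overline\lambda)>0$ for $z,\lambda\in\mathbb{D}$). A weight on $\mathbb{D}$ is a positive function that is integrable on $\mathbb{D}$ with respect to $dA$. For a weight $\omega$ and $1\le p<\infty$, $L^p(\omega)$ is the Banach space of complex-valued (measurable) functions $f$ on $\mathbb{D}$ with $\|f\|_{L^p(\omega)}=\left(\int_{\mathbb{D}}|f|^p\,\omega\,dA\right)^{1/p}<\infty$. A measure $\mu$ on $\mathbb{D}$ is doubling if there is a constant $C>0$ such that $\mu(B(z,2r))\le C\mu(B(z,r))$ for all $z\in\mathbb{D}$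 and $r>0$, where $B(z,r)$ is the Euclidean disk with center $z$ and radius $r$, and the measure of a set means the measure of its intersection with $\mathbb{D}$. A weight $\omega$ is a doubling weight if the measure $\omega\,dA$ is doubling. For an interval (arc) $I\subset\mathbb{T}$ of positive length, $|I|$ denotes its normalized arc length (so $|\mathbb{T}|=1$), and the associated Carleson box is $Q_I=\{z\in\mathbb{D}: z/|z|\in I,\ 1-|I|<|z|<1\}$. Moreover $|Q_I|=\int_{Q_I}dA$ and, for a weight $\omega$, $|Q_I|_\omega=\int_{Q_I}\omega\,dA$. *)

theory Defs
  imports "HOL-Analysis.Analysis"
begin

abbreviation unit_disk :: "complex set" where
  "unit_disk \<equiv> ball 0 1"

definition disk_area :: "complex measure" where
  "disk_area = density (lebesgue_on unit_disk) (\<lambda>_. ennreal (1 / pi))"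

text \<open>Functions on the disk are total functions on the complex plane; nothing below depends on
  their values outside the disk.\<close>

definition weight :: "(complex \<Rightarrow> real) \<Rightarrow> bool" where
  "weight \<omega> \<longleftrightarrow> (\<forall>z\<in>unit_disk. 0 < \<omega> z) \<and> integrable disk_area \<omega>"

definition doubling :: "complex measure \<Rightarrow> bool" where
  "doubling M \<longleftrightarrow> (\<exists>C>0. \<forall>z\<in>unit_disk. \<forall>r>0.
     emeasure M (ball z (2 * r) \<inter> unit_disk) \<le> ennreal C * emeasure M (ball z r \<inter> unit_disk))"

definition doubling_weight :: "(complex \<Rightarrow> real) \<Rightarrow> bool" where
  "doubling_weight \<omega> \<longleftrightarrow>
     weight \<omega> \<and> doubling (density disk_area (\<lambda>z. ennreal (\<omega> z)))"

text \<open>Functions that agree almost everywhere are not identified, so \<open>Lp_norm\<close> is only a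
  seminorm on this set.\<close>

definition Lp :: "real \<Rightarrow> (complex \<Rightarrow> real) \<Rightarrow> (complex \<Rightarrow> complex) set" where
  "Lp p \<omega> = {f \<in> borel_measurable disk_area.
               integrable disk_area (\<lambda>z. norm (f z) powr p * \<omega> z)}"

definition Lp_norm :: "real \<Rightarrow> (complex \<Rightarrow> real) \<Rightarrow> (complex \<Rightarrow> complex) \<Rightarrow> real" where
  "Lp_norm p \<omega> f = (LINT z|disk_area. norm (f z) powr p * \<omega> z) powr (1 / p)"

definition bounded_on_Lp ::
  "real \<Rightarrow> (complex \<Rightarrow> real) \<Rightarrow> ((complex \<Rightarrow> complex) \<Rightarrow> complex \<Rightarrow> complex) \<Rightarrow> bool" where
  "bounded_on_Lp p \<omega> T \<longleftrightarrow>
     (\<exists>C. \<forall>f\<in>Lp p \<omega>. T f \<in> Lp p \<omega> \<and> Lp_norm p \<omega> (T f) \<le> C * Lp_norm p \<omega> f)"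

text \<open>If \<omega> and its dual weight are integrable, Hoelder's inequality shows that every \<open>f\<close> in
  \<open>Lp p \<omega>\<close> is integrable over the disk. The kernel is bounded in \<open>w\<close> for each fixed \<open>z\<close> of the
  disk, so the integral then converges absolutely.\<close>

definition K_op :: "real \<Rightarrow> (complex \<Rightarrow> complex) \<Rightarrow> complex \<Rightarrow> complex" where
  "K_op \<alpha> f z =
     (LINT w|disk_area. f w / (1 - z * cnj w) powr complex_of_real \<alpha>)"

definition arc_length :: "complex set \<Rightarrow> real" where
  "arc_length I = measure lborel {t \<in> {0..<2 * pi}. cis t \<in> I} / (2 * pi)"

text \<open>The interval \<open>J\<close> may be open, closed or half-open, and longer than \<open>2 * pi\<close>, so the
  whole circle is included.\<close>

definition arcs :: "complex set set" where
  "arcs = {I. (\<exists>J::real set. is_interval J \<and> I = cis ` J) \<and> 0 < arc_length I}"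

definition carleson_box :: "complex set \<Rightarrow> complex set" where
  "carleson_box I =
     {z \<in> unit_disk. z / of_real (norm z) \<in> I \<and> 1 - arc_length I < norm z \<and> norm z < 1}"

definition weighted_area :: "(complex \<Rightarrow> real) \<Rightarrow> complex set \<Rightarrow> real" where
  "weighted_area \<omega> A = (LINT z:A|disk_area. \<omega> z)"

definition dual_weight :: "real \<Rightarrow> (complex \<Rightarrow> real) \<Rightarrow> complex \<Rightarrow> real" where
  "dual_weight p' \<omega> z = \<omega> z powr (1 - p')"

definition carleson_characteristic ::
  "real \<Rightarrow> real \<Rightarrow> (complex \<Rightarrow> real) \<Rightarrow> (complex \<Rightarrow> real) \<Rightarrow> ereal" where
  "carleson_characteristic p \<alpha> \<omega> \<sigma> =
     (SUP I\<in>arcs. ereal (weighted_area \<omega> (carleson_box I)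
                           * weighted_area \<sigma> (carleson_box I) powr (p - 1)
                         / measure disk_area (carleson_box I) powr (p * \<alpha> / 2)))"

end

theory Submission
  imports Defs
begin

text \<open>Write \<open>B(z, r)\<close> for \<open>ball z r \<inter> unit_disk\<close>, \<open>\<delta>(z) = 1 - norm z\<close> for the distance to the circle and
\<open>d(z, w) = norm (1 - z * cnj w)\<close>, so that the kernel has modulus \<open>d(z, w) powr - \<alpha>\<close>. On the disk \<open>d\<close> acts
as a distance that never drops below the depth of its points: it dominates \<open>norm (z - w)\<close>,
\<open>\<delta>(z)\<close> and \<open>\<delta>(w)\<close> (\<open>one_minus_mult_cnj_bounds\<close>). A disk \<open>B(z, d)\<close> with \<open>\<delta>(z) \<le> d\<close> reaches the
boundary and is comparable to a Carleson box over an arc of length about \<open>d\<close>; by doubling, the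
finiteness of the characteristic therefore amounts to
\<open>\<omega>(B(z, d)) * \<sigma>(B(z, d)) powr (p - 1) \<le> A * d powr (p * \<alpha>)\<close> for all such disks.

Boundedness implies this by testing (\<open>small_ball_necessary\<close>). On a disk whose radius is a small
multiple of the depth of its centre \<open>\<zeta>\<close> the kernel is almost constant, with value about
\<open>\<delta>(\<zeta>) powr - \<alpha>\<close> up to a constant factor, hence no cancellation occurs in \<open>K_op \<alpha> f\<close> for \<open>f = \<sigma>\<close>
on that disk. Finitely many doublings lead from the small disk to the whole Carleson box.

The converse is a Schur test with a power of \<open>\<delta>\<close> as test function (\<open>weighted_schur_test\<close>). The
condition on disks bounds the kernel by
\<open>\<omega>(B(z, d)) powr (- 1 / p) * \<sigma>(B(z, d)) powr (- 1 / p')\<close> with \<open>d = d(z, w)\<close>. Hoelder's inequality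
with the factors \<open>\<delta>(w) powr b\<close> and \<open>\<delta>(w) powr - b\<close> then reduces the claim to one estimate for each
of the measures \<open>\<mu> = \<omega> dA\<close> and \<open>\<mu> = \<sigma> dA\<close>:
the integral of \<open>\<delta>(z) powr - s / \<mu>(B(w, d(z, w)))\<close> in \<open>d\<mu>(z)\<close> is at most a constant times
\<open>\<delta>(w) powr - s\<close>, for all small \<open>s > 0\<close> (\<open>integral_schur_kernel\<close>). Splitting into the dyadic shells
\<open>d(z, w) \<approx> 2 ^ k * \<delta>(w)\<close>, this follows once the integral of \<open>\<delta> powr - s\<close> over \<open>B(w, r)\<close> is known to be
at most a constant times \<open>r powr - s * \<mu>(B(w, r))\<close> (\<open>integral_collar_power\<close>), because the shells
then contribute a geometric series.

That last fact is where doubling does its real work: a doubling measure cannot concentrate at the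
circle. The part of \<open>B(w, r)\<close> at depth below \<open>r / 2 ^ n\<close> has a share of the mass that decays
geometrically in \<open>n\<close> (\<open>collar_decay\<close>), since each collar of depth \<open>t / 2\<close> has mass at most a constant
times that of the adjacent layer between the depths \<open>t / 2\<close> and \<open>t\<close> (\<open>collar_absorption\<close>).\<close>

section \<open>The disk and the kernel\<close>

lemma space_disk_area [simp]: "space disk_area = unit_disk"
  by (simp add: disk_area_def space_restrict_space)

lemma borel_measurable_ident_disk: "(\<lambda>z. z) \<in> borel_measurable disk_area"
  unfolding disk_area_def
  by (simp add: measurable_completion measurable_restrict_space1)

text \<open>Everything rests on the identity
\<open>norm (1 - z * cnj w) ^ 2 = norm (z - w) ^ 2 + (1 - norm z ^ 2) * (1 - norm w ^ 2)\<close> and on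
\<open>norm (z * cnj w) \<le> min (norm z) (norm w)\<close>. The positive real part keeps the principal branch of
the power away from its cut.\<close>

lemma one_minus_mult_cnj_bounds:
  fixes z w :: complex
  assumes "norm z < 1" "norm w < 1"
  shows "norm (z - w) \<le> norm (1 - z * cnj w)"
    and "1 - norm z \<le> norm (1 - z * cnj w)"
    and "1 - norm w \<le> norm (1 - z * cnj w)"
    and "norm (1 - z * cnj w) \<le> 2"
    and "0 < Re (1 - z * cnj w)"
proof -
  have sq: "(norm (1 - z * cnj w))\<^sup>2 = (norm (z - w))\<^sup>2 + (1 - (norm z)\<^sup>2) * (1 - (norm w)\<^sup>2)"
    unfolding cmod_power2 by (simp add: power2_eq_square algebra_simps)
  have "(norm z)\<^sup>2 \<le> 1" "(norm w)\<^sup>2 \<le> 1"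
    using assms by (simp_all add: power_le_one)
  then have "(norm (z - w))\<^sup>2 \<le> (norm (1 - z * cnj w))\<^sup>2"
    unfolding sq by simp
  then show "norm (z - w) \<le> norm (1 - z * cnj w)"
    by (rule power2_le_imp_le) simp
  have n: "norm (z * cnj w) = norm z * norm w"
    by (simp add: norm_mult)
  have t: "1 - norm z * norm w \<le> norm (1 - z * cnj w)"
    using norm_triangle_ineq2[of 1 "z * cnj w"] unfolding n norm_one .
  have "norm z * norm w \<le> norm z" "norm z * norm w \<le> norm w"
    using assms by (simp_all add: mult_left_le mult_left_le_one_le)
  with t show "1 - norm z \<le> norm (1 - z * cnj w)" "1 - norm w \<le> norm (1 - z * cnj w)"
    by linarith+
  have l1: "norm (z * cnj w) < 1"
    unfolding n using assms \<open>norm z * norm w \<le> norm z\<close> by linarith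
  then show "norm (1 - z * cnj w) \<le> 2"
    using norm_triangle_ineq4[of 1 "z * cnj w"] unfolding norm_one by linarith
  show "0 < Re (1 - z * cnj w)"
    using l1 complex_Re_le_cmod[of "z * cnj w"] unfolding minus_complex.sel one_complex.sel by linarith
qed

lemma borel_measurable_cnj [measurable]: "cnj \<in> borel_measurable borel"
  by (intro borel_measurable_continuous_onI continuous_intros)

lemma disk_ball_sets: "ball z r \<inter> unit_disk \<in> sets disk_area"
proof -
  note [measurable] = borel_measurable_ident_disk
  have "ball z r \<inter> unit_disk = {x \<in> space disk_area. dist z x < r}" by auto
  also have "\<dots> \<in> sets disk_area" by measurable
  finally show ?thesis .
qed

lemma finite_measure_disk_area: "finite_measure disk_area"
proof
  have "emeasure disk_area (space disk_area) = ennreal (1 / pi) * emeasure (lebesgue_on unit_disk) unit_disk"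
    unfolding disk_area_def by (simp add: emeasure_density_const space_restrict_space)
  also have "\<dots> < top"
    using emeasure_bounded_finite[OF bounded_ball, of "0 :: complex" 1]
    by (simp add: emeasure_restrict_space ennreal_mult_less_top)
  finally show "emeasure disk_area (space disk_area) \<noteq> \<infinity>"
    by simp
qed

section \<open>Doubling measures near the boundary of the disk\<close>

lemma dyadic_scale:
  fixes a x :: real
  assumes "0 < a" "a \<le> x"
  obtains n :: nat where "2 ^ n * a \<le> x" "x < 2 ^ Suc n * a"
proof -
  obtain m :: nat where m: "x / a < 2 ^ m"
    using real_arch_pow[of 2 "x / a"] by auto
  define k where "k = (LEAST m :: nat. x < 2 ^ m * a)"
  have k: "x < 2 ^ k * a"
    unfolding k_def by (rule LeastI[of _ m]) (use m assms in \<open>simp add: field_simps\<close>)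
  then have "k \<noteq> 0"
    using assms by (cases k) auto
  then obtain n where n: "k = Suc n"
    by (cases k) auto
  have "\<not> x < 2 ^ n * a"
    using not_less_Least[of n "\<lambda>m. x < 2 ^ m * a"] n unfolding k_def by simp
  then show thesis
    using that[of n] k n by simp
qed

lemma powr_dyadic_mult:
  fixes a s :: real
  shows "(2 ^ n * a) powr s = (2 powr s) ^ n * a powr s"
proof (induction n)
  case (Suc n)
  have "(2 ^ Suc n * a) powr s = (2 * (2 ^ n * a)) powr s"
    by (simp add: mult.assoc)
  also have "\<dots> = 2 powr s * (2 ^ n * a) powr s"
    by (rule powr_mult)
  finally show ?case
    using Suc by simp
qed simp

lemma le_suminf_ennreal: "f n \<le> (\<Sum>n. f n)" for f :: "nat \<Rightarrow> ennreal"
  using sum_le_suminf[of f "{n}"] by simp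

text \<open>Finiteness allows the doubling inequality to be read in the reals, and positivity of the mass of
every disk allows division by it.\<close>

locale doubling_disk_measure = finite_measure \<mu> for \<mu> :: "complex measure" +
  fixes C :: real
  assumes sets_eq: "sets \<mu> = sets disk_area"
    and C_ge_1: "1 \<le> C"
    and measure_ball_pos: "z \<in> unit_disk \<Longrightarrow> 0 < r \<Longrightarrow> 0 < measure \<mu> (ball z r \<inter> unit_disk)"
    and measure_ball_double: "z \<in> unit_disk \<Longrightarrow> 0 < r \<Longrightarrow>
      measure \<mu> (ball z (2 * r) \<inter> unit_disk) \<le> C * measure \<mu> (ball z r \<inter> unit_disk)"
begin

definition mass :: "complex \<Rightarrow> real \<Rightarrow> real" where
  "mass z r = measure \<mu> (ball z r \<inter> unit_disk)"

lemmas mass_pos = measure_ball_pos[folded mass_def]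
lemmas mass_double = measure_ball_double[folded mass_def]

lemma mass_nonneg [simp]: "0 \<le> mass z r"
  by (simp add: mass_def)

lemma emeasure_disk_ball: "emeasure \<mu> (ball z r \<inter> unit_disk) = ennreal (mass z r)"
  by (simp add: mass_def emeasure_eq_measure)

lemma space_eq [simp]: "space \<mu> = unit_disk"
  using sets_eq_imp_space_eq[OF sets_eq] by simp

lemma ident_measurable [measurable]: "(\<lambda>z. z) \<in> borel_measurable \<mu>"
  using borel_measurable_ident_disk measurable_cong_sets[OF sets_eq refl] by blast

lemma ball_sets [measurable]: "ball z r \<inter> unit_disk \<in> sets \<mu>"
  unfolding sets_eq by (rule disk_ball_sets)

lemma mass_measurable [measurable]:
  assumes [measurable]: "f \<in> borel_measurable N" "g \<in> borel_measurable N"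
  shows "(\<lambda>x. mass (f x) (g x)) \<in> borel_measurable N"
proof -
  have "mass (f x) (g x) = enn2real (\<integral>\<^sup>+\<zeta>. (if dist (f x) \<zeta> < g x then 1 else 0) \<partial>\<mu>)" for x
  proof -
    have "(\<integral>\<^sup>+\<zeta>. (if dist (f x) \<zeta> < g x then 1 else 0) \<partial>\<mu>)
        = (\<integral>\<^sup>+\<zeta>. indicator (ball (f x) (g x) \<inter> unit_disk) \<zeta> \<partial>\<mu>)"
      by (rule nn_integral_cong) (auto simp: indicator_def)
    then show ?thesis
      by (simp add: mass_def measure_def)
  qed
  then show ?thesis by simp
qed

lemma mass_mono:
  assumes "dist z w + r \<le> s"
  shows "mass z r \<le> mass w s"
  unfolding mass_def
proof (rule finite_measure_mono)
  show "ball z r \<inter> unit_disk \<subseteq> ball w s \<inter> unit_disk"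
  proof
    fix x assume "x \<in> ball z r \<inter> unit_disk"
    then show "x \<in> ball w s \<inter> unit_disk"
      using assms dist_triangle[of w x z] by (simp add: dist_commute)
  qed
qed simp

lemma mass_double_iter:
  assumes "z \<in> unit_disk" "0 < r"
  shows "mass z (2 ^ n * r) \<le> C ^ n * mass z r"
proof (induction n)
  case (Suc n)
  have "mass z (2 ^ Suc n * r) \<le> C * mass z (2 ^ n * r)"
    using mass_double[of z "2 ^ n * r"] assms by (simp add: mult.assoc)
  also have "\<dots> \<le> C * (C ^ n * mass z r)"
    using Suc C_ge_1 by (intro mult_left_mono) auto
  finally show ?case by (simp add: mult.assoc)
qed simp

text \<open>Doubling for disks with different centres: the first disk lies in the \<open>2 ^ n\<close>-fold enlargement of
the second.\<close>

lemma mass_compare: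
  assumes "w \<in> unit_disk" "0 < s" "dist z w + r \<le> 2 ^ n * s"
  shows "mass z r \<le> C ^ n * mass w s"
  using mass_mono[OF assms(3)] mass_double_iter[OF assms(1,2), of n] by linarith

text \<open>For \<open>z\<close> in the collar of depth \<open>t / 2\<close>, the disk \<open>B(z, t)\<close> contains a disk of radius
\<open>t / 4\<close> inside the layer between the depths \<open>t / 2\<close> and \<open>t\<close>, so by doubling that layer fills a
fixed share of \<open>B(z, 2 * t)\<close>. Instead of covering the collar by disjoint pieces, this local
estimate is averaged over \<open>z\<close>: the integral over pairs \<open>(z, \<zeta>)\<close> at distance less than \<open>t\<close> of
\<open>1 / mass z (2 * t)\<close> is evaluated in the other order, where \<open>B(\<zeta>, t) \<subseteq> B(z, 2 * t)\<close> bounds the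
inner integral by 1.\<close>

lemma collar_absorption:
  assumes t: "0 < t" "t \<le> 1"
  shows "measure \<mu> {z \<in> ball w \<rho> \<inter> unit_disk. 1 - norm z < t / 2}
       \<le> C ^ 4 * measure \<mu> {z \<in> ball w (\<rho> + t) \<inter> unit_disk. t / 2 \<le> 1 - norm z \<and> 1 - norm z < t}"
    (is "measure \<mu> ?E \<le> _ * measure \<mu> ?S")
proof -
  have [measurable]: "?E \<in> sets \<mu>" "?S \<in> sets \<mu>"
  proof -
    have "?E = {z \<in> space \<mu>. dist w z < \<rho> \<and> 1 - norm z < t / 2}" by auto
    also have "\<dots> \<in> sets \<mu>" by measurable
    finally show "?E \<in> sets \<mu>" .
    have "?S = {z \<in> space \<mu>. dist w z < \<rho> + t \<and> t / 2 \<le> 1 - norm z \<and> 1 - norm z < t}" by auto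
    also have "\<dots> \<in> sets \<mu>" by measurable
    finally show "?S \<in> sets \<mu>" .
  qed
  have C4: "0 \<le> C ^ 4"
    using C_ge_1 by simp
  let ?k = "\<lambda>z \<zeta>. if dist z \<zeta> < t then ennreal (1 / mass z (2 * t)) else 0"
  have nearby: "mass z (2 * t) \<le> C ^ 4 * measure \<mu> (ball z t \<inter> ?S)" if "z \<in> ?E" for z
  proof -
    have nz: "1 - t / 2 < norm z" "norm z < 1" "dist w z < \<rho>"
      using that by auto
    then have "0 < norm z"
      using t by linarith
    note nz = nz this
    \<comment> \<open>\<open>v\<close> is the point of depth \<open>3 * t / 4\<close> on the radius through \<open>z\<close>, in the middle of the layer.\<close>
    define c where "c = (1 - 3 * t / 4) / norm z"
    define v where "v = of_real c * z"
    have c: "c * norm z = 1 - 3 * t / 4" "0 \<le> c"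
      using nz t by (simp_all add: c_def)
    have norm_v: "norm v = 1 - 3 * t / 4"
      using c by (simp add: v_def norm_mult)
    have "v - z = of_real (c - 1) * z"
      by (simp add: v_def left_diff_distrib)
    then have "dist v z = \<bar>c - 1\<bar> * norm z"
      unfolding dist_norm by (simp only: norm_mult norm_of_real)
    also have "\<dots> = \<bar>(c - 1) * norm z\<bar>"
      by (simp only: abs_mult abs_norm_cancel)
    also have "(c - 1) * norm z = c * norm z - norm z"
      by (simp only: left_diff_distrib mult_1)
    finally have dvz: "dist v z < 3 * t / 4"
      unfolding c(1) using nz t by (simp add: abs_if split: if_splits)
    have sub: "ball v (t / 4) \<inter> unit_disk \<subseteq> ball z t \<inter> ?S"
    proof
      fix x assume x: "x \<in> ball v (t / 4) \<inter> unit_disk"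
      then have 1: "dist v x < t / 4" by simp
      then have "\<bar>norm v - norm x\<bar> < t / 4"
        using norm_triangle_ineq3[of v x] by (simp add: dist_norm)
      moreover have 2: "dist z x < t"
        using 1 dvz dist_triangle[of z x v] by (simp add: dist_commute)
      moreover have "dist w x < \<rho> + t"
        using 2 nz dist_triangle[of w x z] by simp
      ultimately show "x \<in> ball z t \<inter> ?S"
        using x norm_v by (auto simp: abs_if split: if_splits)
    qed
    have "v \<in> unit_disk" using norm_v t by simp
    moreover have "dist z v + 2 * t \<le> 2 ^ 4 * (t / 4)"
      using dvz t by (simp add: dist_commute)
    ultimately have "mass z (2 * t) \<le> C ^ 4 * mass v (t / 4)"
      using t by (intro mass_compare) auto
    also have "\<dots> \<le> C ^ 4 * measure \<mu> (ball z t \<inter> ?S)"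
      unfolding mass_def
    proof (intro mult_left_mono finite_measure_mono sub)
      have eq: "ball z t \<inter> ?S = (ball z t \<inter> unit_disk) \<inter> ?S" by auto
      show "ball z t \<inter> ?S \<in> sets \<mu>" unfolding eq by measurable
    qed (use C_ge_1 in auto)
    finally show ?thesis .
  qed
  have "emeasure \<mu> ?E = (\<integral>\<^sup>+z. indicator ?E z \<partial>\<mu>)"
    by (rule nn_integral_indicator[symmetric]) measurable
  also have "\<dots> \<le> (\<integral>\<^sup>+z. ennreal (C ^ 4) * (\<integral>\<^sup>+\<zeta>. ?k z \<zeta> * indicator ?S \<zeta> \<partial>\<mu>) \<partial>\<mu>)"
  proof (rule nn_integral_mono)
    fix z assume "z \<in> space \<mu>"
    show "indicator ?E z \<le> ennreal (C ^ 4) * (\<integral>\<^sup>+\<zeta>. ?k z \<zeta> * indicator ?S \<zeta> \<partial>\<mu>)"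
    proof (cases "z \<in> ?E")
      case True
      then have mp: "0 < mass z (2 * t)"
        using t by (intro mass_pos) auto
      have eq: "ball z t \<inter> ?S = (ball z t \<inter> unit_disk) \<inter> ?S" by auto
      have "(\<integral>\<^sup>+\<zeta>. ?k z \<zeta> * indicator ?S \<zeta> \<partial>\<mu>)
          = (\<integral>\<^sup>+\<zeta>. ennreal (1 / mass z (2 * t)) * indicator (ball z t \<inter> ?S) \<zeta> \<partial>\<mu>)"
        by (rule nn_integral_cong) (auto simp: indicator_def)
      also have "\<dots> = ennreal (1 / mass z (2 * t)) * emeasure \<mu> (ball z t \<inter> ?S)"
        by (rule nn_integral_cmult_indicator) (unfold eq, measurable)
      also have "\<dots> = ennreal (measure \<mu> (ball z t \<inter> ?S) / mass z (2 * t))"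
        by (simp add: emeasure_eq_measure flip: ennreal_mult)
      finally have eq2: "(\<integral>\<^sup>+\<zeta>. ?k z \<zeta> * indicator ?S \<zeta> \<partial>\<mu>)
          = ennreal (measure \<mu> (ball z t \<inter> ?S) / mass z (2 * t))" .
      have "1 \<le> C ^ 4 * (measure \<mu> (ball z t \<inter> ?S) / mass z (2 * t))"
        using nearby[OF True] mp by (simp add: field_simps)
      then have "1 \<le> ennreal (C ^ 4) * (\<integral>\<^sup>+\<zeta>. ?k z \<zeta> * indicator ?S \<zeta> \<partial>\<mu>)"
        unfolding eq2 ennreal_mult'[OF C4, symmetric] ennreal_1[symmetric] by (rule ennreal_leI)
      then show ?thesis
        using True by (simp only: indicator_simps)
    next
      case False
      show ?thesis unfolding indicator_simps(2)[OF False] by (rule zero_le)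
    qed
  qed
  also have "\<dots> = ennreal (C ^ 4) * (\<integral>\<^sup>+z. \<integral>\<^sup>+\<zeta>. ?k z \<zeta> * indicator ?S \<zeta> \<partial>\<mu> \<partial>\<mu>)"
    by (rule nn_integral_cmult) measurable
  also have "(\<integral>\<^sup>+z. \<integral>\<^sup>+\<zeta>. ?k z \<zeta> * indicator ?S \<zeta> \<partial>\<mu> \<partial>\<mu>)
      = (\<integral>\<^sup>+\<zeta>. \<integral>\<^sup>+z. ?k z \<zeta> * indicator ?S \<zeta> \<partial>\<mu> \<partial>\<mu>)"
  proof -
    interpret P: pair_sigma_finite \<mu> \<mu> by unfold_locales
    show ?thesis
      by (rule P.Fubini'[symmetric]) measurable
  qed
  also have "\<dots> \<le> (\<integral>\<^sup>+\<zeta>. indicator ?S \<zeta> \<partial>\<mu>)"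
  proof (rule nn_integral_mono)
    fix \<zeta> assume \<zeta>: "\<zeta> \<in> space \<mu>"
    have mp: "0 < mass \<zeta> t"
      using t \<zeta> by (intro mass_pos) auto
    have "(\<integral>\<^sup>+z. ?k z \<zeta> \<partial>\<mu>) \<le> (\<integral>\<^sup>+z. ennreal (1 / mass \<zeta> t) * indicator (ball \<zeta> t \<inter> unit_disk) z \<partial>\<mu>)"
    proof (rule nn_integral_mono)
      fix z assume z: "z \<in> space \<mu>"
      have "mass \<zeta> t \<le> mass z (2 * t)" if "dist z \<zeta> < t"
        using that by (intro mass_mono) (simp add: dist_commute)
      then show "?k z \<zeta> \<le> ennreal (1 / mass \<zeta> t) * indicator (ball \<zeta> t \<inter> unit_disk) z"
        using z mp by (auto simp: indicator_def dist_commute intro!: ennreal_leI divide_left_mono)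
    qed
    also have "\<dots> = ennreal (1 / mass \<zeta> t) * emeasure \<mu> (ball \<zeta> t \<inter> unit_disk)"
      by (rule nn_integral_cmult_indicator) simp
    also have "\<dots> = 1"
      using mp by (simp add: emeasure_disk_ball flip: ennreal_mult)
    finally have "(\<integral>\<^sup>+z. ?k z \<zeta> \<partial>\<mu>) \<le> 1" .
    moreover have "(\<integral>\<^sup>+z. ?k z \<zeta> * indicator ?S \<zeta> \<partial>\<mu>) = (\<integral>\<^sup>+z. ?k z \<zeta> \<partial>\<mu>) * indicator ?S \<zeta>"
      by (rule nn_integral_multc) (use \<zeta> in measurable)
    ultimately show "(\<integral>\<^sup>+z. ?k z \<zeta> * indicator ?S \<zeta> \<partial>\<mu>) \<le> indicator ?S \<zeta>"
      by (simp split: split_indicator)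
  qed
  also have "(\<integral>\<^sup>+\<zeta>. indicator ?S \<zeta> \<partial>\<mu>) = emeasure \<mu> ?S"
    by (rule nn_integral_indicator) measurable
  finally have "emeasure \<mu> ?E \<le> ennreal (C ^ 4) * emeasure \<mu> ?S"
    by (simp add: mult_left_mono)
  then have "ennreal (measure \<mu> ?E) \<le> ennreal (C ^ 4 * measure \<mu> ?S)"
    using C_ge_1 by (simp add: emeasure_eq_measure ennreal_mult)
  then show ?thesis
    using C_ge_1 by (simp add: ennreal_le_iff)
qed

lemma collar_sets [measurable]: "{z \<in> ball w r \<inter> unit_disk. 1 - norm z < t} \<in> sets \<mu>"
proof -
  have "{z \<in> ball w r \<inter> unit_disk. 1 - norm z < t} = {z \<in> space \<mu>. dist w z < r \<and> 1 - norm z < t}"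
    by auto
  also have "\<dots> \<in> sets \<mu>" by measurable
  finally show ?thesis .
qed

text \<open>A collar whose mass is at most \<open>C ^ 4\<close> times the mass added when its depth is doubled has at
most the share \<open>C ^ 4 / (1 + C ^ 4)\<close> of the mass of the doubled collar; this is iterated \<open>n\<close> times.\<close>

lemma collar_decay:
  assumes t: "0 < t" "t \<le> 1"
  shows "measure \<mu> {z \<in> ball w r \<inter> unit_disk. 1 - norm z < t / 2 ^ n}
       \<le> (C ^ 4 / (1 + C ^ 4)) ^ n * mass w (r + 2 * t)"
proof -
  \<comment> \<open>Absorption enlarges the disk by the depth of the collar. The radii are chosen so that the
    enlargements \<open>t, t / 2, t / 4, \<dots>\<close> are used up in turn; they add up to \<open>2 * t\<close>.\<close>
  let ?E = "\<lambda>n. {z \<in> ball w (r + 2 * (t / 2 ^ n)) \<inter> unit_disk. 1 - norm z < t / 2 ^ n}"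
  let ?\<theta> = "C ^ 4 / (1 + C ^ 4)"
  have C4: "0 < C ^ 4" using C_ge_1 by simp
  have step: "measure \<mu> (?E (Suc n)) \<le> ?\<theta> * measure \<mu> (?E n)" for n
  proof -
    define u where "u = t / 2 ^ n"
    let ?S = "{z \<in> ball w (r + u + u) \<inter> unit_disk. u / 2 \<le> 1 - norm z \<and> 1 - norm z < u}"
    let ?F = "{z \<in> ball w (r + u) \<inter> unit_disk. 1 - norm z < u / 2}"
    have u: "0 < u" "u \<le> 1"
      using t by (auto simp: u_def field_simps intro: order_trans[OF _ one_le_power])
    have E_Suc: "?E (Suc n) = ?F"
      by (auto simp: u_def)
    have E_n: "?E n = {z \<in> ball w (r + u + u) \<inter> unit_disk. 1 - norm z < u}"
      by (auto simp: u_def)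
    have "?S = {z \<in> space \<mu>. dist w z < r + u + u \<and> u / 2 \<le> 1 - norm z \<and> 1 - norm z < u}"
      by auto
    also have "\<dots> \<in> sets \<mu>" by measurable
    finally have S: "?S \<in> sets \<mu>" .
    have F: "?F \<in> sets \<mu>" by measurable
    have "measure \<mu> ?F + measure \<mu> ?S = measure \<mu> (?F \<union> ?S)"
      by (rule finite_measure_Union[symmetric, OF F S]) auto
    also have "\<dots> \<le> measure \<mu> (?E n)"
    proof (rule finite_measure_mono)
      show "?F \<union> ?S \<subseteq> ?E n"
        unfolding E_n using u by auto
    qed measurable
    finally have "C ^ 4 * measure \<mu> ?S \<le> C ^ 4 * (measure \<mu> (?E n) - measure \<mu> ?F)"
      using C4 by (intro mult_left_mono) auto
    then have "measure \<mu> ?F \<le> C ^ 4 * (measure \<mu> (?E n) - measure \<mu> ?F)"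
      using collar_absorption[OF u, of w "r + u"] by linarith
    then have "(1 + C ^ 4) * measure \<mu> ?F \<le> C ^ 4 * measure \<mu> (?E n)"
      by (simp add: algebra_simps)
    then show ?thesis
      unfolding E_Suc times_divide_eq_left using C4
      by (subst pos_le_divide_eq) (simp_all only: mult.commute add_pos_pos zero_less_one)
  qed
  have "measure \<mu> (?E n) \<le> ?\<theta> ^ n * measure \<mu> (?E 0)"
  proof (induction n)
    case (Suc n)
    have "measure \<mu> (?E (Suc n)) \<le> ?\<theta> * measure \<mu> (?E n)"
      by (rule step)
    also have "\<dots> \<le> ?\<theta> * (?\<theta> ^ n * measure \<mu> (?E 0))"
      by (rule mult_left_mono[OF Suc]) (use C4 in simp)
    finally show ?case by (simp only: power_Suc mult.assoc)
  qed simp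
  moreover have "measure \<mu> {z \<in> ball w r \<inter> unit_disk. 1 - norm z < t / 2 ^ n} \<le> measure \<mu> (?E n)"
  proof (rule finite_measure_mono)
    have "0 \<le> 2 * (t / 2 ^ n)" using t by simp
    then show "{z \<in> ball w r \<inter> unit_disk. 1 - norm z < t / 2 ^ n} \<subseteq> ?E n"
      by fastforce
  qed measurable
  moreover have "measure \<mu> (?E 0) \<le> mass w (r + 2 * t)"
    unfolding mass_def by (rule finite_measure_mono) auto
  then have "?\<theta> ^ n * measure \<mu> (?E 0) \<le> ?\<theta> ^ n * mass w (r + 2 * t)"
    using C4 by (intro mult_left_mono) auto
  ultimately show ?thesis by linarith
qed

text \<open>The integrand is split along depths proportional to \<open>r / 2 ^ n\<close>. The mass of the collars decays like a power
\<open>\<theta> ^ n\<close> with \<open>\<theta> < 1\<close>, which beats the growth \<open>2 powr (s * n)\<close> of the integrand as long as \<open>s\<close> is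
small. The bound 4 on the radius covers every shell in which \<open>norm (1 - z * cnj w) \<le> 2\<close>.\<close>

lemma integral_collar_power:
  obtains s\<^sub>0 where "0 < s\<^sub>0"
    "\<And>s. 0 < s \<Longrightarrow> s \<le> s\<^sub>0 \<Longrightarrow> \<exists>K>0. \<forall>w r. w \<in> unit_disk \<longrightarrow> 0 < r \<longrightarrow> r \<le> 4 \<longrightarrow>
      (\<integral>\<^sup>+z. ennreal ((1 - norm z) powr - s) * indicator (ball w r) z \<partial>\<mu>)
        \<le> ennreal (K * r powr - s * mass w r)"
proof -
  define \<theta> where "\<theta> = C ^ 4 / (1 + C ^ 4)"
  have C4: "0 < C ^ 4" using C_ge_1 by simp
  have \<theta>: "0 < \<theta>" "\<theta> < 1"
    unfolding \<theta>_def using C4 by (simp_all only: divide_pos_pos add_pos_pos zero_less_one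
        pos_divide_less_eq[OF add_pos_pos[OF zero_less_one C4]]) simp
  \<comment> \<open>The choice makes \<open>2 powr s * \<theta> < 1\<close> for all \<open>s \<le> s\<^sub>0\<close>.\<close>
  define s\<^sub>0 where "s\<^sub>0 = - log 2 \<theta> / 2"
  have "log 2 \<theta> < 0"
    using \<theta> by simp
  then have s0: "0 < s\<^sub>0" "s\<^sub>0 < - log 2 \<theta>"
    by (simp_all add: s\<^sub>0_def)
  have "\<exists>K>0. \<forall>w r. w \<in> unit_disk \<longrightarrow> 0 < r \<longrightarrow> r \<le> 4 \<longrightarrow>
      (\<integral>\<^sup>+z. ennreal ((1 - norm z) powr - s) * indicator (ball w r) z \<partial>\<mu>)
        \<le> ennreal (K * r powr - s * mass w r)" if s: "0 < s" "s \<le> s\<^sub>0" for s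
  proof -
    define q where "q = 2 powr s * \<theta>"
    have "2 powr s < 2 powr (- log 2 \<theta>)"
      using s s0 by (intro powr_less_mono) auto
    also have "\<dots> = 1 / \<theta>"
      using \<theta> by (simp add: powr_minus_divide)
    finally have q: "0 < q" "q < 1"
      using \<theta> by (simp_all add: q_def field_simps)
    define K where "K = 8 powr s * (1 + 2 powr s * C / (1 - q))"
    have "0 < K"
      unfolding K_def using q C_ge_1 by (intro mult_pos_pos add_pos_nonneg) auto
    moreover have "(\<integral>\<^sup>+z. ennreal ((1 - norm z) powr - s) * indicator (ball w r) z \<partial>\<mu>)
        \<le> ennreal (K * r powr - s * mass w r)"
      if w: "w \<in> unit_disk" and r: "0 < r" "r \<le> 4" for w r
    proof -
      \<comment> \<open>The collars have depth \<open>r / 4 / 2 ^ n\<close>, twice the scale \<open>a / 2 ^ n\<close>, because the dyadic scale of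
        a depth is found with a weak inequality and the collars are defined by a strict one.\<close>
      define a where "a = r / 8"
      have a: "0 < a" using r by (simp add: a_def)
      let ?B = "ball w r \<inter> unit_disk"
      let ?E = "\<lambda>n. {z \<in> ball w r \<inter> unit_disk. 1 - norm z < r / 4 / 2 ^ n}"
      let ?c = "\<lambda>n. a powr - s * (2 powr s) ^ Suc n"
      have c_nonneg: "0 \<le> ?c n" for n by simp
      have "(\<integral>\<^sup>+z. ennreal ((1 - norm z) powr - s) * indicator (ball w r) z \<partial>\<mu>)
          \<le> (\<integral>\<^sup>+z. ennreal (a powr - s) * indicator ?B z
                + (\<Sum>n. ennreal (?c n) * indicator (?E n) z) \<partial>\<mu>)"
      proof (rule nn_integral_mono)
        fix z assume "z \<in> space \<mu>"
        then have z: "z \<in> unit_disk" by simp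
        show "ennreal ((1 - norm z) powr - s) * indicator (ball w r) z
            \<le> ennreal (a powr - s) * indicator ?B z + (\<Sum>n. ennreal (?c n) * indicator (?E n) z)"
        proof (cases "z \<in> ball w r")
          case False
          then show ?thesis by simp
        next
          case True
          have \<delta>: "0 < 1 - norm z" using z by simp
          show ?thesis
          proof (cases "1 - norm z \<le> a")
            case False
            then have "(1 - norm z) powr - s \<le> a powr - s"
              using s a by (intro powr_mono2') auto
            then have "ennreal ((1 - norm z) powr - s) \<le> ennreal (a powr - s)"
              by (rule ennreal_leI)
            moreover have "indicator (ball w r) z = (1 :: ennreal)" "indicator ?B z = (1 :: ennreal)"
              using True z by auto
            ultimately show ?thesis
              by (simp add: add_increasing2)
          next
            case le: True
            obtain n where n: "2 ^ n * (1 - norm z) \<le> a" "a < 2 ^ Suc n * (1 - norm z)"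
              using dyadic_scale[OF \<delta> le] .
            have "1 - norm z \<le> a / 2 ^ n"
              using n by (simp add: field_simps)
            also have "\<dots> < r / 4 / 2 ^ n"
              using r by (simp add: a_def field_simps)
            finally have "1 - norm z < r / 4 / 2 ^ n" .
            then have E: "indicator (?E n) z = (1 :: ennreal)" "indicator (ball w r) z = (1 :: ennreal)"
              using True z by auto
            have "(2 ^ Suc n * (1 - norm z)) powr - s \<le> a powr - s"
              using s a n by (intro powr_mono2') auto
            then have "(2 powr - s) ^ Suc n * (1 - norm z) powr - s \<le> a powr - s"
              unfolding powr_dyadic_mult .
            then have "(2 powr s) ^ Suc n * ((2 powr - s) ^ Suc n * (1 - norm z) powr - s) \<le> ?c n"
              by (subst mult.commute[of "a powr - s"]) (intro mult_left_mono, simp_all)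
            moreover have "2 powr s * 2 powr - s = (1 :: real)"
              by (simp add: powr_minus)
            ultimately have "(1 - norm z) powr - s \<le> ?c n"
              by (simp only: mult.assoc[symmetric] power_mult_distrib[symmetric] power_one mult_1)
            then have "ennreal ((1 - norm z) powr - s) \<le> ennreal (?c n)"
              by (rule ennreal_leI)
            then have "ennreal ((1 - norm z) powr - s) * indicator (ball w r) z
                \<le> ennreal (?c n) * indicator (?E n) z"
              unfolding E by simp
            also have "\<dots> \<le> (\<Sum>n. ennreal (?c n) * indicator (?E n) z)"
              by (rule le_suminf_ennreal)
            finally show ?thesis
              by (simp add: add_increasing)
          qed
        qed
      qed
      also have "\<dots> = (\<integral>\<^sup>+z. ennreal (a powr - s) * indicator ?B z \<partial>\<mu>)
          + (\<integral>\<^sup>+z. (\<Sum>n. ennreal (?c n) * indicator (?E n) z) \<partial>\<mu>)"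
        by (rule nn_integral_add) measurable
      also have "(\<integral>\<^sup>+z. ennreal (a powr - s) * indicator ?B z \<partial>\<mu>) = ennreal (a powr - s * mass w r)"
        by (subst nn_integral_cmult_indicator) (simp_all add: emeasure_disk_ball ennreal_mult)
      also have "(\<integral>\<^sup>+z. (\<Sum>n. ennreal (?c n) * indicator (?E n) z) \<partial>\<mu>)
          = (\<Sum>n. \<integral>\<^sup>+z. ennreal (?c n) * indicator (?E n) z \<partial>\<mu>)"
        by (rule nn_integral_suminf) measurable
      also have "\<dots> \<le> (\<Sum>n. ennreal (a powr - s * 2 powr s * C * mass w r * q ^ n))"
      proof (rule suminf_le)
        fix n
        have "(\<integral>\<^sup>+z. ennreal (?c n) * indicator (?E n) z \<partial>\<mu>) = ennreal (?c n * measure \<mu> (?E n))"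
          by (subst nn_integral_cmult_indicator)
            (simp_all only: collar_sets emeasure_eq_measure ennreal_mult[OF c_nonneg measure_nonneg])
        also have "\<dots> \<le> ennreal (a powr - s * 2 powr s * C * mass w r * q ^ n)"
        proof (rule ennreal_leI)
          have "measure \<mu> (?E n) \<le> \<theta> ^ n * mass w (r + 2 * (r / 4))"
            unfolding \<theta>_def using r by (intro collar_decay) auto
          also have "mass w (r + 2 * (r / 4)) \<le> C ^ 1 * mass w r"
            using w r by (intro mass_compare) auto
          finally have "measure \<mu> (?E n) \<le> \<theta> ^ n * (C * mass w r)"
            using \<theta> by simp
          then have "?c n * measure \<mu> (?E n) \<le> ?c n * (\<theta> ^ n * (C * mass w r))"
            by (rule mult_left_mono[OF _ c_nonneg])
          then show "?c n * measure \<mu> (?E n) \<le> a powr - s * 2 powr s * C * mass w r * q ^ n"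
            by (simp add: q_def power_mult_distrib mult_ac)
        qed
        finally show "(\<integral>\<^sup>+z. ennreal (?c n) * indicator (?E n) z \<partial>\<mu>)
            \<le> ennreal (a powr - s * 2 powr s * C * mass w r * q ^ n)" .
      qed auto
      also have "\<dots> = ennreal (\<Sum>n. a powr - s * 2 powr s * C * mass w r * q ^ n)"
        using q C_ge_1 by (intro suminf_ennreal2 summable_mult summable_geometric) auto
      also have "(\<Sum>n. a powr - s * 2 powr s * C * mass w r * q ^ n)
          = a powr - s * 2 powr s * C * mass w r * (1 / (1 - q))"
        using q by (subst suminf_mult) (auto simp: suminf_geometric intro!: summable_geometric)
      also have "ennreal (a powr - s * mass w r) + ennreal (a powr - s * 2 powr s * C * mass w r * (1 / (1 - q)))
          = ennreal (a powr - s * (1 + 2 powr s * C / (1 - q)) * mass w r)"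
        using q C_ge_1 by (subst ennreal_plus[symmetric]) (auto simp: field_simps)
      also have "a powr - s = 8 powr s * r powr - s"
        using r by (simp add: a_def powr_divide powr_minus field_simps)
      finally show ?thesis
        by (simp add: K_def mult_ac add_left_mono)
    qed
    ultimately show ?thesis by blast
  qed
  with s0 show thesis
    using that by blast
qed

text \<open>On the shell where \<open>norm (1 - z * cnj w)\<close> lies between \<open>2 ^ k * \<delta>\<close> and \<open>2 ^ Suc k * \<delta>\<close>, with
\<open>\<delta> = 1 - norm w\<close>, the mass in the denominator is comparable to the mass of the disk about \<open>w\<close> that
contains the shell, and the collar integral over this disk is at most a constant times
\<open>(2 ^ k * \<delta>) powr - s\<close> times that mass. The masses cancel and the rest is a geometric series.\<close>

lemma integral_schur_kernel:
  assumes s: "0 < s" and K: "0 < K"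
    and collar: "\<And>w r. w \<in> unit_disk \<Longrightarrow> 0 < r \<Longrightarrow> r \<le> 4 \<Longrightarrow>
      (\<integral>\<^sup>+z. ennreal ((1 - norm z) powr - s) * indicator (ball w r) z \<partial>\<mu>)
        \<le> ennreal (K * r powr - s * mass w r)"
    and w: "w \<in> unit_disk"
  shows "(\<integral>\<^sup>+z. ennreal ((1 - norm z) powr - s / mass w (norm (1 - z * cnj w))) \<partial>\<mu>)
    \<le> ennreal (C * K / (2 powr s - 1) * (1 - norm w) powr - s)"
proof -
  define \<delta> where "\<delta> = 1 - norm w"
  have \<delta>: "0 < \<delta>" using w by (simp add: \<delta>_def)
  let ?r = "\<lambda>k. 2 ^ Suc k * \<delta>"
  \<comment> \<open>\<open>T k\<close> dominates the integrand on the \<open>k\<close>-th shell. The shells with \<open>2 ^ k * \<delta> > 2\<close> are empty; the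
    case distinction keeps the radius \<open>2 ^ Suc k * \<delta>\<close> below 4.\<close>
  define T where "T k z = (if 2 ^ k * \<delta> \<le> 2
      then ennreal (C / mass w (?r k)) * (ennreal ((1 - norm z) powr - s) * indicator (ball w (?r k)) z)
      else 0)" for k :: nat and z
  have [measurable]: "ball w r \<in> sets borel" for r by simp
  have T_meas [measurable]: "T k \<in> borel_measurable \<mu>" for k
    unfolding T_def by measurable
  have m: "0 < mass w (?r k)" for k
    using w \<delta> by (intro mass_pos) auto
  have "(\<integral>\<^sup>+z. ennreal ((1 - norm z) powr - s / mass w (norm (1 - z * cnj w))) \<partial>\<mu>)
      \<le> (\<integral>\<^sup>+z. (\<Sum>k. T k z) \<partial>\<mu>)"
  proof (rule nn_integral_mono)
    fix z assume "z \<in> space \<mu>"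
    then have z: "norm z < 1" by simp
    let ?d = "norm (1 - z * cnj w)"
    have d: "norm (z - w) \<le> ?d" "\<delta> \<le> ?d" "?d \<le> 2"
      using one_minus_mult_cnj_bounds[OF z, of w] w by (auto simp: \<delta>_def)
    obtain k where k: "2 ^ k * \<delta> \<le> ?d" "?d < ?r k"
      using dyadic_scale[OF \<delta> d(2)] .
    have md: "0 < mass w ?d"
      using w d \<delta> by (intro mass_pos) auto
    have "mass w (?r k) \<le> C * mass w (2 ^ k * \<delta>)"
      using mass_double[of w "2 ^ k * \<delta>"] w \<delta> by (simp add: mult.assoc)
    also have "\<dots> \<le> C * mass w ?d"
      using k C_ge_1 by (intro mult_left_mono mass_mono) auto
    finally have "1 / mass w ?d \<le> C / mass w (?r k)"
      using m[of k] md by (simp add: field_simps)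
    then have "(1 - norm z) powr - s * (1 / mass w ?d) \<le> (1 - norm z) powr - s * (C / mass w (?r k))"
      by (intro mult_left_mono) auto
    then have "ennreal ((1 - norm z) powr - s / mass w ?d)
        \<le> ennreal (C / mass w (?r k) * (1 - norm z) powr - s)"
      by (intro ennreal_leI) (simp add: mult_ac)
    also have "\<dots> = T k z"
    proof -
      have "z \<in> ball w (?r k)"
        using d(1) k(2) by (simp add: dist_norm norm_minus_commute)
      moreover have "2 ^ k * \<delta> \<le> 2"
        using k d by linarith
      moreover have "0 \<le> C / mass w (?r k)"
        using C_ge_1 by simp
      ultimately show ?thesis
        unfolding T_def by (simp only: if_True indicator_simps mult_1_right ennreal_mult[OF _ powr_ge_zero])
    qed
    also have "\<dots> \<le> (\<Sum>k. T k z)"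
      by (rule le_suminf_ennreal)
    finally show "ennreal ((1 - norm z) powr - s / mass w ?d) \<le> (\<Sum>k. T k z)" .
  qed
  also have "\<dots> = (\<Sum>k. \<integral>\<^sup>+z. T k z \<partial>\<mu>)"
    by (rule nn_integral_suminf) measurable
  also have "\<dots> \<le> (\<Sum>k. ennreal (C * K * \<delta> powr - s * 2 powr - s * (2 powr - s) ^ k))"
  proof (rule suminf_le)
    fix k
    show "(\<integral>\<^sup>+z. T k z \<partial>\<mu>) \<le> ennreal (C * K * \<delta> powr - s * 2 powr - s * (2 powr - s) ^ k)"
    proof (cases "2 ^ k * \<delta> \<le> 2")
      case True
      have "(\<integral>\<^sup>+z. T k z \<partial>\<mu>) = ennreal (C / mass w (?r k)) *
          (\<integral>\<^sup>+z. ennreal ((1 - norm z) powr - s) * indicator (ball w (?r k)) z \<partial>\<mu>)"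
        unfolding T_def using True by (simp only: if_True) (rule nn_integral_cmult, measurable)
      also have "\<dots> \<le> ennreal (C / mass w (?r k)) * ennreal (K * ?r k powr - s * mass w (?r k))"
        using True \<delta> w by (intro mult_left_mono collar) (auto simp: mult.commute)
      also have "\<dots> = ennreal (C / mass w (?r k) * (K * ?r k powr - s * mass w (?r k)))"
        using C_ge_1 K by (intro ennreal_mult[symmetric]) auto
      also have "C / mass w (?r k) * (K * ?r k powr - s * mass w (?r k)) = C * K * ?r k powr - s"
        using m[of k] by (simp add: field_simps)
      also have "\<dots> = C * K * \<delta> powr - s * 2 powr - s * (2 powr - s) ^ k"
        unfolding powr_dyadic_mult by (simp add: mult_ac)
      finally show ?thesis by simp
    qed (simp add: T_def)
  qed auto
  also have "\<dots> = ennreal (\<Sum>k. C * K * \<delta> powr - s * 2 powr - s * (2 powr - s) ^ k)"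
    using s K C_ge_1
    by (intro suminf_ennreal2 summable_mult summable_geometric) (auto simp: powr_less_one)
  also have "(\<Sum>k. C * K * \<delta> powr - s * 2 powr - s * (2 powr - s) ^ k)
      = C * K * \<delta> powr - s * 2 powr - s * (1 / (1 - 2 powr - s))"
    using s by (subst suminf_mult) (auto simp: suminf_geometric powr_less_one intro!: summable_geometric)
  also have "\<dots> = C * K / (2 powr s - 1) * \<delta> powr - s"
  proof -
    have "2 powr s > 2 powr 0" using s by (intro powr_less_mono) auto
    then show ?thesis by (simp add: powr_minus[of 2] divide_simps)
  qed
  finally show ?thesis by (simp add: \<delta>_def)
qed

end

section \<open>Hoelder's inequality and the weighted Schur test\<close>

text \<open>The \<open>p\<close>-th power of Hoelder's inequality, in a form where the integral of \<open>u powr p\<close> may be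
infinite. It is obtained by integrating Young's inequality for \<open>t * u\<close> and \<open>v / t\<close> with the optimal
scaling \<open>t\<close>.\<close>

lemma nn_integral_Holder_powr:
  fixes p q V x :: real and u v :: "'a \<Rightarrow> real"
  assumes pq: "p > 1" "q > 1" "1 / p + 1 / q = 1"
    and [measurable]: "u \<in> borel_measurable M" "v \<in> borel_measurable M"
    and nonneg: "\<And>w. w \<in> space M \<Longrightarrow> 0 \<le> u w" "\<And>w. w \<in> space M \<Longrightarrow> 0 \<le> v w"
    and V: "0 < V" "(\<integral>\<^sup>+w. ennreal (v w powr q) \<partial>M) \<le> ennreal V"
    and x: "0 \<le> x" "ennreal x \<le> (\<integral>\<^sup>+w. ennreal (u w * v w) \<partial>M)"
  shows "ennreal (x powr p) \<le> ennreal (V powr (p / q)) * (\<integral>\<^sup>+w. ennreal (u w powr p) \<partial>M)"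
proof (cases "(\<integral>\<^sup>+w. ennreal (u w powr p) \<partial>M) = top")
  case True
  then show ?thesis using V by (simp add: ennreal_mult_top)
next
  case False
  then obtain U where U: "0 \<le> U" "(\<integral>\<^sup>+w. ennreal (u w powr p) \<partial>M) = ennreal U"
    by (cases "\<integral>\<^sup>+w. ennreal (u w powr p) \<partial>M") auto
  have pq': "p + q = p * q"
    using pq by (simp add: field_simps)
  have conj: "- (1 / q) + 1 = 1 / p" "- (1 / p) + 1 = 1 / q"
    using pq by linarith+
  \<comment> \<open>Working with \<open>U' > U\<close> covers the case \<open>U = 0\<close>, in which no optimal scaling exists.\<close>
  have "x powr p / V powr (p / q) \<le> U'" if U': "U < U'" for U'
  proof -
    have U'_pos: "0 < U'" using U U' by linarith
    \<comment> \<open>With this scaling \<open>t powr p * U'\<close> and \<open>t powr - q * V\<close> coincide.\<close>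
    define t where "t = (V / U') powr (1 / (p * q))"
    have t: "0 < t" using V U'_pos by (simp add: t_def)
    have tp: "t powr p * U' = U' powr (1 / p) * V powr (1 / q)"
    proof -
      have "t powr p = (V / U') powr (1 / q)"
        using pq by (simp add: t_def powr_powr)
      also have "\<dots> * U' = V powr (1 / q) * (U' powr - (1 / q) * U' powr 1)"
        using V U'_pos by (simp add: powr_divide powr_minus field_simps)
      also have "U' powr - (1 / q) * U' powr 1 = U' powr (1 / p)"
        by (simp only: conj flip: powr_add)
      finally show ?thesis by simp
    qed
    have tq: "t powr - q * V = U' powr (1 / p) * V powr (1 / q)"
    proof -
      have "t powr - q = (V / U') powr - (1 / p)"
        using pq by (simp add: t_def powr_powr)
      also have "\<dots> * V = U' powr (1 / p) * (V powr - (1 / p) * V powr 1)"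
        using V U'_pos by (simp add: powr_divide powr_minus field_simps)
      also have "V powr - (1 / p) * V powr 1 = V powr (1 / q)"
        by (simp only: conj flip: powr_add)
      finally show ?thesis by simp
    qed
    have "ennreal x \<le> (\<integral>\<^sup>+w. ennreal (u w * v w) \<partial>M)" by (rule x)
    also have "\<dots> \<le> (\<integral>\<^sup>+w. ennreal (t powr p / p) * ennreal (u w powr p)
        + ennreal (t powr - q / q) * ennreal (v w powr q) \<partial>M)"
    proof (rule nn_integral_mono)
      fix w assume w: "w \<in> space M"
      have "u w * v w = (t * u w) * (v w / t)" using t by simp
      also have "\<dots> \<le> (t * u w) powr p / p + (v w / t) powr q / q"
        using t nonneg w pq by (intro Youngs_inequality) auto
      also have "\<dots> = t powr p / p * u w powr p + t powr - q / q * v w powr q"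
        using t nonneg w by (simp add: powr_mult powr_divide powr_minus field_simps)
      finally have "ennreal (u w * v w)
          \<le> ennreal (t powr p / p * u w powr p + t powr - q / q * v w powr q)"
        by (rule ennreal_leI)
      also have "\<dots> = ennreal (t powr p / p) * ennreal (u w powr p)
        + ennreal (t powr - q / q) * ennreal (v w powr q)"
        using pq by (simp add: ennreal_plus flip: ennreal_mult)
      finally show "ennreal (u w * v w) \<le> ennreal (t powr p / p) * ennreal (u w powr p)
        + ennreal (t powr - q / q) * ennreal (v w powr q)" .
    qed
    also have "\<dots> = ennreal (t powr p / p) * (\<integral>\<^sup>+w. ennreal (u w powr p) \<partial>M)
        + ennreal (t powr - q / q) * (\<integral>\<^sup>+w. ennreal (v w powr q) \<partial>M)"
      by (simp add: nn_integral_add nn_integral_cmult)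
    also have "\<dots> \<le> ennreal (t powr p / p) * ennreal U' + ennreal (t powr - q / q) * ennreal V"
      using U U' V by (intro add_mono mult_left_mono) (auto intro: ennreal_leI)
    also have "\<dots> = ennreal (t powr p * U' / p + t powr - q * V / q)"
      using pq V U'_pos by (simp flip: ennreal_mult)
    also have "t powr p * U' / p + t powr - q * V / q = U' powr (1 / p) * V powr (1 / q) * (1 / p + 1 / q)"
      unfolding tp tq by (simp add: algebra_simps)
    finally have "x \<le> U' powr (1 / p) * V powr (1 / q)"
      using x pq by (simp add: ennreal_le_iff)
    then have "x powr p \<le> (U' powr (1 / p) * V powr (1 / q)) powr p"
      using x pq by (intro powr_mono2) auto
    also have "\<dots> = U' * V powr (p / q)"
      using pq U'_pos by (simp add: powr_mult powr_powr)
    finally show ?thesis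
      using V by (simp add: field_simps)
  qed
  then have "x powr p / V powr (p / q) \<le> U"
    by (rule dense_ge)
  then have "x powr p \<le> V powr (p / q) * U"
    using V by (simp add: field_simps)
  then have "ennreal (x powr p) \<le> ennreal (V powr (p / q) * U)"
    by (rule ennreal_leI)
  then show ?thesis
    using U by (simp add: ennreal_mult)
qed

text \<open>The hypothesis \<open>bound\<close> replaces the kernel by a product of two factors, one governed by the
measure \<open>\<omega> dA\<close> and one by \<open>\<sigma> dA\<close>, so that Hoelder's inequality in \<open>w\<close> followed by an exchange of
the integrals leaves exactly one Schur integral for each measure. The function \<open>x\<close> stands for the
modulus of the image of \<open>f\<close>; only a pointwise bound by the integral of the absolute values is
assumed, so that the integral may be infinite at some points.\<close>

lemma weighted_schur_test:
  fixes \<alpha> p q A C\<^sub>1 C\<^sub>2 :: real and \<omega> \<sigma> :: "complex \<Rightarrow> real"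
  assumes pq: "p > 1" "q > 1" "1 / p + 1 / q = 1"
    and meas: "\<omega> \<in> borel_measurable disk_area" "\<sigma> \<in> borel_measurable disk_area"
    and pos: "\<And>z. z \<in> unit_disk \<Longrightarrow> 0 < \<omega> z" "\<And>z. z \<in> unit_disk \<Longrightarrow> 0 < \<sigma> z"
    and dual: "\<And>z. z \<in> unit_disk \<Longrightarrow> \<omega> z powr (1 / p) * \<sigma> z powr (1 / q) = 1"
    and doubling: "doubling_disk_measure (density disk_area (\<lambda>z. ennreal (\<omega> z))) C\<^sub>1"
      "doubling_disk_measure (density disk_area (\<lambda>z. ennreal (\<sigma> z))) C\<^sub>2"
    and A: "0 < A"
    and bound: "\<And>z d. z \<in> unit_disk \<Longrightarrow> 1 - norm z \<le> d \<Longrightarrow> d \<le> 2 \<Longrightarrow>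
      measure (density disk_area (\<lambda>z. ennreal (\<omega> z))) (ball z d \<inter> unit_disk)
      * measure (density disk_area (\<lambda>z. ennreal (\<sigma> z))) (ball z d \<inter> unit_disk) powr (p - 1)
      \<le> A * d powr (p * \<alpha>)"
  obtains B where "0 < B" "\<And>f x. f \<in> borel_measurable disk_area \<Longrightarrow>
    (\<And>z. z \<in> unit_disk \<Longrightarrow> 0 \<le> x z \<and>
      ennreal (x z) \<le> (\<integral>\<^sup>+w. ennreal (norm (f w) * norm (1 - z * cnj w) powr - \<alpha>) \<partial>disk_area)) \<Longrightarrow>
    (\<integral>\<^sup>+z. ennreal (x z powr p * \<omega> z) \<partial>disk_area)
      \<le> ennreal B * (\<integral>\<^sup>+w. ennreal (norm (f w :: complex) powr p * \<omega> w) \<partial>disk_area)"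
proof -
  let ?\<mu> = "density disk_area (\<lambda>z. ennreal (\<omega> z))"
  let ?\<nu> = "density disk_area (\<lambda>z. ennreal (\<sigma> z))"
  interpret M: finite_measure disk_area by (rule finite_measure_disk_area)
  interpret \<mu>: doubling_disk_measure ?\<mu> C\<^sub>1 by (rule doubling)
  interpret \<nu>: doubling_disk_measure ?\<nu> C\<^sub>2 by (rule doubling)
  note [measurable] = meas borel_measurable_ident_disk
  note [measurable] = \<mu>.mass_measurable \<nu>.mass_measurable
  obtain s\<^sub>1 where s1: "0 < s\<^sub>1"
    "\<And>s. 0 < s \<Longrightarrow> s \<le> s\<^sub>1 \<Longrightarrow> \<exists>K>0. \<forall>w r. w \<in> unit_disk \<longrightarrow> 0 < r \<longrightarrow> r \<le> 4 \<longrightarrow>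
      (\<integral>\<^sup>+z. ennreal ((1 - norm z) powr - s) * indicator (ball w r) z \<partial>?\<mu>)
        \<le> ennreal (K * r powr - s * \<mu>.mass w r)"
    using \<mu>.integral_collar_power by blast
  obtain s\<^sub>2 where s2: "0 < s\<^sub>2"
    "\<And>s. 0 < s \<Longrightarrow> s \<le> s\<^sub>2 \<Longrightarrow> \<exists>K>0. \<forall>w r. w \<in> unit_disk \<longrightarrow> 0 < r \<longrightarrow> r \<le> 4 \<longrightarrow>
      (\<integral>\<^sup>+z. ennreal ((1 - norm z) powr - s) * indicator (ball w r) z \<partial>?\<nu>)
        \<le> ennreal (K * r powr - s * \<nu>.mass w r)"
    using \<nu>.integral_collar_power by blast
  \<comment> \<open>The test function is \<open>(1 - norm w) powr b\<close>; it enters the two Schur integrals with the exponents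
    \<open>b * p\<close> and \<open>b * q\<close>, both of which have to be small.\<close>
  define b where "b = min (s\<^sub>1 / p) (s\<^sub>2 / q)"
  have b: "0 < b" "0 < b * p" "b * p \<le> s\<^sub>1" "0 < b * q" "b * q \<le> s\<^sub>2"
    using s1(1) s2(1) pq by (auto simp: b_def min_def field_simps)
  obtain k\<^sub>1 where k1: "0 < k\<^sub>1" "\<And>w r. w \<in> unit_disk \<Longrightarrow> 0 < r \<Longrightarrow> r \<le> 4 \<Longrightarrow>
      (\<integral>\<^sup>+z. ennreal ((1 - norm z) powr - (b * p)) * indicator (ball w r) z \<partial>?\<mu>)
        \<le> ennreal (k\<^sub>1 * r powr - (b * p) * \<mu>.mass w r)"
    using s1(2)[OF b(2,3)] by blast
  obtain k\<^sub>2 where k2: "0 < k\<^sub>2" "\<And>w r. w \<in> unit_disk \<Longrightarrow> 0 < r \<Longrightarrow> r \<le> 4 \<Longrightarrow>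
      (\<integral>\<^sup>+z. ennreal ((1 - norm z) powr - (b * q)) * indicator (ball w r) z \<partial>?\<nu>)
        \<le> ennreal (k\<^sub>2 * r powr - (b * q) * \<nu>.mass w r)"
    using s2(2)[OF b(4,5)] by blast
  define K\<^sub>1 where "K\<^sub>1 = C\<^sub>1 * k\<^sub>1 / (2 powr (b * p) - 1)"
  define K\<^sub>2 where "K\<^sub>2 = C\<^sub>2 * k\<^sub>2 / (2 powr (b * q) - 1)"
  have "1 < (2 :: real) powr (b * p)" "1 < (2 :: real) powr (b * q)"
    using b by (simp_all add: gr_one_powr)
  then have K: "0 < K\<^sub>1" "0 < K\<^sub>2"
    using k1(1) k2(1) \<mu>.C_ge_1 \<nu>.C_ge_1 by (simp_all add: K\<^sub>1_def K\<^sub>2_def)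
  have S1: "(\<integral>\<^sup>+z. ennreal (\<omega> z) * ennreal ((1 - norm z) powr - (b * p) / \<mu>.mass w (norm (1 - z * cnj w))) \<partial>disk_area)
      \<le> ennreal (K\<^sub>1 * (1 - norm w) powr - (b * p))" if "w \<in> unit_disk" for w
  proof -
    have "(\<integral>\<^sup>+z. ennreal ((1 - norm z) powr - (b * p) / \<mu>.mass w (norm (1 - z * cnj w))) \<partial>?\<mu>)
        \<le> ennreal (K\<^sub>1 * (1 - norm w) powr - (b * p))"
      unfolding K\<^sub>1_def using \<mu>.integral_schur_kernel[OF b(2) k1 that] .
    then show ?thesis
      by (subst (asm) nn_integral_density) measurable
  qed
  have S2: "(\<integral>\<^sup>+w. ennreal (\<sigma> w) * ennreal ((1 - norm w) powr - (b * q) / \<nu>.mass z (norm (1 - z * cnj w))) \<partial>disk_area)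
      \<le> ennreal (K\<^sub>2 * (1 - norm z) powr - (b * q))" if "z \<in> unit_disk" for z
  proof -
    have sym: "norm (1 - w * cnj z) = norm (1 - z * cnj w)" for w
      using complex_mod_cnj[of "1 - w * cnj z"] by (simp add: mult.commute)
    have "(\<integral>\<^sup>+w. ennreal ((1 - norm w) powr - (b * q) / \<nu>.mass z (norm (1 - w * cnj z))) \<partial>?\<nu>)
        \<le> ennreal (K\<^sub>2 * (1 - norm z) powr - (b * q))"
      unfolding K\<^sub>2_def using \<nu>.integral_schur_kernel[OF b(4) k2 that] .
    then show ?thesis
      unfolding sym by (subst (asm) nn_integral_density) measurable
  qed
  define D where "D = K\<^sub>2 powr (p / q) * (A * C\<^sub>1)"
  have D: "0 < D"
    unfolding D_def using K A \<mu>.C_ge_1 by simp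
  have main: "(\<integral>\<^sup>+z. ennreal (x z powr p * \<omega> z) \<partial>disk_area)
      \<le> ennreal (D * K\<^sub>1) * (\<integral>\<^sup>+w. ennreal (norm (f w) powr p * \<omega> w) \<partial>disk_area)"
    if f [measurable]: "f \<in> borel_measurable disk_area"
      and x: "\<And>z. z \<in> unit_disk \<Longrightarrow> 0 \<le> x z \<and>
      ennreal (x z) \<le> (\<integral>\<^sup>+w. ennreal (norm (f w) * norm (1 - z * cnj w) powr - \<alpha>) \<partial>disk_area)"
    for f :: "complex \<Rightarrow> complex" and x
  proof -
    let ?d = "\<lambda>z w. norm (1 - z * cnj w)"
    let ?G = "\<lambda>z w. ennreal (D * (norm (f w) powr p * \<omega> w * (1 - norm w) powr (b * p)))
        * (ennreal (\<omega> z) * ennreal ((1 - norm z) powr - (b * p) / \<mu>.mass w (?d z w)))"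
    have pointwise: "ennreal (x z powr p * \<omega> z) \<le> (\<integral>\<^sup>+w. ?G z w \<partial>disk_area)" if z: "z \<in> unit_disk" for z
    proof -
      \<comment> \<open>The product \<open>u * v\<close> dominates the integrand, since \<open>\<omega> powr (1 / p) * \<sigma> powr (1 / q) = 1\<close> and the
        powers of \<open>1 - norm w\<close> cancel. The integral of \<open>v powr q\<close> is a Schur integral for \<open>\<sigma> dA\<close>.\<close>
      define u where "u w = A powr (1 / p) * \<mu>.mass z (?d z w) powr - (1 / p) * norm (f w)
          * \<omega> w powr (1 / p) * (1 - norm w) powr b" for w
      define v where "v w = \<nu>.mass z (?d z w) powr - (1 / q) * \<sigma> w powr (1 / q) * (1 - norm w) powr - b" for w
      define V where "V = K\<^sub>2 * (1 - norm z) powr - (b * q)"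
      have \<delta>z: "0 < 1 - norm z" using z by simp
      have V: "0 < V" using K \<delta>z by (simp add: V_def)
      have uv_meas [measurable]: "u \<in> borel_measurable disk_area" "v \<in> borel_measurable disk_area"
        unfolding u_def v_def by measurable
      have facts: "0 < \<mu>.mass z (?d z w)" "0 < \<nu>.mass z (?d z w)" "0 < 1 - norm w" "0 < ?d z w"
        "0 < \<omega> w" "0 < \<sigma> w" "?d z w \<le> 2" "1 - norm z \<le> ?d z w"
        "\<mu>.mass w (?d z w) \<le> C\<^sub>1 * \<mu>.mass z (?d z w)" "0 < \<mu>.mass w (?d z w)"
        if w: "w \<in> space disk_area" for w
      proof -
        have nw: "norm z < 1" "norm w < 1" using w z by simp_all
        note bd = one_minus_mult_cnj_bounds[OF nw]
        show d: "0 < ?d z w" using bd(2) nw by linarith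
        show "0 < \<mu>.mass z (?d z w)" "0 < \<nu>.mass z (?d z w)" "0 < \<mu>.mass w (?d z w)"
          using d z w by (auto intro!: \<mu>.mass_pos \<nu>.mass_pos)
        show "0 < 1 - norm w" "0 < \<omega> w" "0 < \<sigma> w" using w pos by auto
        show "?d z w \<le> 2" "1 - norm z \<le> ?d z w" by (rule bd)+
        \<comment> \<open>Recentring the disk at \<open>w\<close> makes the integral in \<open>z\<close> a Schur integral for \<open>\<omega> dA\<close> based at \<open>w\<close>.\<close>
        have "\<mu>.mass w (?d z w) \<le> C\<^sub>1 ^ 1 * \<mu>.mass z (?d z w)"
          using z d bd(1) by (intro \<mu>.mass_compare) (auto simp: dist_norm norm_minus_commute)
        then show "\<mu>.mass w (?d z w) \<le> C\<^sub>1 * \<mu>.mass z (?d z w)" by simp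
      qed
      have "(\<integral>\<^sup>+w. ennreal (v w powr q) \<partial>disk_area)
          = (\<integral>\<^sup>+w. ennreal (\<sigma> w) * ennreal ((1 - norm w) powr - (b * q) / \<nu>.mass z (?d z w)) \<partial>disk_area)"
      proof (rule nn_integral_cong)
        fix w assume w: "w \<in> space disk_area"
        have "v w powr q = \<nu>.mass z (?d z w) powr - 1 * \<sigma> w powr 1 * (1 - norm w) powr - (b * q)"
          unfolding v_def using pq by (simp add: powr_mult powr_powr)
        then have v_q: "v w powr q = \<sigma> w * ((1 - norm w) powr - (b * q) / \<nu>.mass z (?d z w))"
          using facts[OF w] by (simp add: powr_minus_divide)
        show "ennreal (v w powr q) = ennreal (\<sigma> w) * ennreal ((1 - norm w) powr - (b * q) / \<nu>.mass z (?d z w))"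
          unfolding v_q by (rule ennreal_mult) (use facts[OF w] in simp_all)
      qed
      also have "\<dots> \<le> ennreal V"
        unfolding V_def by (rule S2[OF z])
      finally have vV: "(\<integral>\<^sup>+w. ennreal (v w powr q) \<partial>disk_area) \<le> ennreal V" .
      have "ennreal (x z) \<le> (\<integral>\<^sup>+w. ennreal (norm (f w) * ?d z w powr - \<alpha>) \<partial>disk_area)"
        using x z by blast
      also have "\<dots> \<le> (\<integral>\<^sup>+w. ennreal (u w * v w) \<partial>disk_area)"
      proof (rule nn_integral_mono)
        fix w assume w: "w \<in> space disk_area"
        note F = facts[OF w]
        let ?m = "\<mu>.mass z (?d z w)" and ?n = "\<nu>.mass z (?d z w)"
        have "(?m * ?n powr (p - 1)) powr (1 / p) \<le> (A * ?d z w powr (p * \<alpha>)) powr (1 / p)"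
          using bound[OF z F(8,7)] pq
          by (intro powr_mono2) (simp_all add: \<mu>.mass_def \<nu>.mass_def)
        then have "?m powr (1 / p) * ?n powr ((p - 1) / p) \<le> A powr (1 / p) * ?d z w powr \<alpha>"
          using pq by (simp add: powr_mult powr_powr)
        moreover have "(p - 1) / p = 1 / q"
          using pq by (simp add: field_simps)
        ultimately have "?m powr (1 / p) * ?n powr (1 / q) \<le> A powr (1 / p) * ?d z w powr \<alpha>"
          by simp
        then have k: "?d z w powr - \<alpha> \<le> A powr (1 / p) * ?m powr - (1 / p) * ?n powr - (1 / q)"
          using F A by (simp add: powr_minus field_simps)
        have "u w * v w = (A powr (1 / p) * ?m powr - (1 / p) * ?n powr - (1 / q)) * norm (f w)
            * (\<omega> w powr (1 / p) * \<sigma> w powr (1 / q)) * ((1 - norm w) powr b * (1 - norm w) powr - b)"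
          unfolding u_def v_def by (simp only: mult_ac)
        also have "\<dots> = (A powr (1 / p) * ?m powr - (1 / p) * ?n powr - (1 / q)) * norm (f w)"
          using dual[of w] w F by (simp add: powr_minus)
        finally have "norm (f w) * ?d z w powr - \<alpha> \<le> u w * v w"
          using mult_left_mono[OF k, of "norm (f w)"] by (simp add: mult.commute)
        then show "ennreal (norm (f w) * ?d z w powr - \<alpha>) \<le> ennreal (u w * v w)"
          by (rule ennreal_leI)
      qed
      finally have "ennreal (x z powr p) \<le> ennreal (V powr (p / q)) * (\<integral>\<^sup>+w. ennreal (u w powr p) \<partial>disk_area)"
        using x z V vV facts A
        by (intro nn_integral_Holder_powr[OF pq uv_meas]) (auto simp: u_def v_def)
      then have "ennreal (x z powr p) * ennreal (\<omega> z)
          \<le> ennreal (V powr (p / q)) * (\<integral>\<^sup>+w. ennreal (u w powr p) \<partial>disk_area) * ennreal (\<omega> z)"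
        by (rule mult_right_mono) simp
      also have "\<dots> = (\<integral>\<^sup>+w. ennreal (V powr (p / q)) * ennreal (u w powr p) * ennreal (\<omega> z) \<partial>disk_area)"
        by (simp add: nn_integral_cmult nn_integral_multc)
      also have "\<dots> \<le> (\<integral>\<^sup>+w. ?G z w \<partial>disk_area)"
      proof (rule nn_integral_mono)
        fix w assume w: "w \<in> space disk_area"
        note F = facts[OF w]
        let ?m = "\<mu>.mass z (?d z w)"
        have "V powr (p / q) = K\<^sub>2 powr (p / q) * (1 - norm z) powr - (b * p)"
          unfolding V_def using pq by (simp add: powr_mult powr_powr)
        moreover have "u w powr p = A powr 1 * ?m powr - 1 * norm (f w) powr p * \<omega> w powr 1 * (1 - norm w) powr (b * p)"
          unfolding u_def using pq by (simp add: powr_mult powr_powr)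
        then have "u w powr p = A / ?m * norm (f w) powr p * \<omega> w * (1 - norm w) powr (b * p)"
          using F A by (simp add: powr_minus_divide)
        moreover have "1 / ?m \<le> C\<^sub>1 / \<mu>.mass w (?d z w)"
          using F by (simp add: field_simps)
        then have "(K\<^sub>2 powr (p / q) * (1 - norm z) powr - (b * p) * A * norm (f w) powr p * \<omega> w
              * (1 - norm w) powr (b * p) * \<omega> z) * (1 / ?m)
            \<le> (K\<^sub>2 powr (p / q) * (1 - norm z) powr - (b * p) * A * norm (f w) powr p * \<omega> w
              * (1 - norm w) powr (b * p) * \<omega> z) * (C\<^sub>1 / \<mu>.mass w (?d z w))"
          using F A pos[OF z] by (intro mult_left_mono) auto
        ultimately have "V powr (p / q) * u w powr p * \<omega> z
            \<le> D * (norm (f w) powr p * \<omega> w * (1 - norm w) powr (b * p))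
              * (\<omega> z * ((1 - norm z) powr - (b * p) / \<mu>.mass w (?d z w)))"
          by (simp add: D_def mult_ac)
        then have le: "ennreal (V powr (p / q) * u w powr p * \<omega> z)
            \<le> ennreal (D * (norm (f w) powr p * \<omega> w * (1 - norm w) powr (b * p))
              * (\<omega> z * ((1 - norm z) powr - (b * p) / \<mu>.mass w (?d z w))))"
          by (rule ennreal_leI)
        have nonneg: "0 \<le> D * (norm (f w) powr p * \<omega> w * (1 - norm w) powr (b * p))"
          "0 \<le> \<omega> z" "0 \<le> (1 - norm z) powr - (b * p) / \<mu>.mass w (?d z w)"
          using D F(5) pos[OF z] by simp_all
        show "ennreal (V powr (p / q)) * ennreal (u w powr p) * ennreal (\<omega> z) \<le> ?G z w"
          using le unfolding ennreal_mult[OF nonneg(1) mult_nonneg_nonneg[OF nonneg(2,3)]]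
            ennreal_mult[OF nonneg(2,3)]
          by (simp add: ennreal_mult nonneg(2))
      qed
      finally show ?thesis
        using pos[OF z] by (simp add: ennreal_mult)
    qed
    have "(\<integral>\<^sup>+z. ennreal (x z powr p * \<omega> z) \<partial>disk_area)
        \<le> (\<integral>\<^sup>+z. \<integral>\<^sup>+w. ?G z w \<partial>disk_area \<partial>disk_area)"
      by (rule nn_integral_mono) (use pointwise in simp)
    also have "\<dots> = (\<integral>\<^sup>+w. \<integral>\<^sup>+z. ?G z w \<partial>disk_area \<partial>disk_area)"
    proof -
      interpret P: pair_sigma_finite disk_area disk_area by unfold_locales
      show ?thesis by (rule P.Fubini'[symmetric]) measurable
    qed
    also have "\<dots> \<le> (\<integral>\<^sup>+w. ennreal (D * K\<^sub>1) * ennreal (norm (f w) powr p * \<omega> w) \<partial>disk_area)"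
    proof (rule nn_integral_mono)
      fix w assume w: "w \<in> space disk_area"
      let ?c = "D * (norm (f w) powr p * \<omega> w * (1 - norm w) powr (b * p))"
      have c: "0 \<le> ?c" using D pos(1)[of w] w by (auto intro!: mult_nonneg_nonneg simp: less_imp_le)
      have "(\<integral>\<^sup>+z. ?G z w \<partial>disk_area) = ennreal ?c *
          (\<integral>\<^sup>+z. ennreal (\<omega> z) * ennreal ((1 - norm z) powr - (b * p) / \<mu>.mass w (?d z w)) \<partial>disk_area)"
        by (rule nn_integral_cmult) measurable
      also have "\<dots> \<le> ennreal ?c * ennreal (K\<^sub>1 * (1 - norm w) powr - (b * p))"
        using w by (intro mult_left_mono S1) auto
      also have "\<dots> = ennreal (?c * (K\<^sub>1 * (1 - norm w) powr - (b * p)))"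
        by (rule ennreal_mult[symmetric, OF c]) (use K in simp)
      also have "?c * (K\<^sub>1 * (1 - norm w) powr - (b * p)) = D * K\<^sub>1 * (norm (f w) powr p * \<omega> w)"
        using w by (simp add: powr_minus)
      also have "ennreal \<dots> = ennreal (D * K\<^sub>1) * ennreal (norm (f w) powr p * \<omega> w)"
        by (rule ennreal_mult) (use D K pos(1)[of w] w in \<open>auto intro!: mult_nonneg_nonneg simp: less_imp_le\<close>)
      finally show "(\<integral>\<^sup>+z. ?G z w \<partial>disk_area) \<le> ennreal (D * K\<^sub>1) * ennreal (norm (f w) powr p * \<omega> w)" .
    qed
    also have "\<dots> = ennreal (D * K\<^sub>1) * (\<integral>\<^sup>+w. ennreal (norm (f w) powr p * \<omega> w) \<partial>disk_area)"
      by (rule nn_integral_cmult) measurable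
    finally show ?thesis .
  qed
  show thesis
  proof (rule that)
    show "0 < D * K\<^sub>1" using D K by simp
  qed (rule main)
qed

section \<open>Arcs and their Carleson boxes\<close>

lemma is_interval_atLeastAtMost_subset:
  fixes a b :: real
  assumes "is_interval J" "a \<in> J" "b \<in> J"
  shows "{a..b} \<subseteq> J"
  using assms unfolding is_interval_1 by (meson atLeastAtMost_iff subsetI)

text \<open>An interval of any kind is a countable union of compact intervals, so its image under the
continuous map \<open>cis\<close> is a countable union of compact sets.\<close>

lemma borel_cis_image:
  assumes "is_interval J"
  shows "cis ` J \<in> sets borel"
proof -
  \<comment> \<open>Rational points and the endpoints that belong to \<open>J\<close> suffice as ends of the compact pieces.\<close>
  define E where "E = {x \<in> J. x \<in> \<rat> \<or> (\<forall>y\<in>J. x \<le> y) \<or> (\<forall>y\<in>J. y \<le> x)}"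
  have least: "{x \<in> J. \<forall>y\<in>J. x \<le> y} \<subseteq> {Inf J}"
    by (auto intro!: cInf_eq_minimum[symmetric])
  have greatest: "{x \<in> J. \<forall>y\<in>J. y \<le> x} \<subseteq> {Sup J}"
    by (auto intro!: cSup_eq_maximum[symmetric])
  have "E \<subseteq> \<rat> \<union> {Inf J} \<union> {Sup J}"
    using least greatest unfolding E_def by blast
  then have E: "countable E"
    by (rule countable_subset) (simp add: countable_rat)
  note sub = is_interval_atLeastAtMost_subset[OF assms]
  have "J \<subseteq> (\<Union>i\<in>E \<times> E. {fst i..snd i})"
  proof
    fix x assume x: "x \<in> J"
    have "\<exists>a\<in>E. a \<le> x"
    proof (cases "\<forall>y\<in>J. x \<le> y")
      case True
      then show ?thesis using x by (auto simp: E_def)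
    next
      case False
      then obtain y where y: "y \<in> J" "y < x" by (auto simp: not_le)
      then obtain r where r: "r \<in> \<rat>" "y < r" "r < x" using Rats_dense_in_real by blast
      then have "r \<in> J" using sub[OF y(1) x] by auto
      then show ?thesis using r by (auto simp: E_def)
    qed
    moreover have "\<exists>b\<in>E. x \<le> b"
    proof (cases "\<forall>y\<in>J. y \<le> x")
      case True
      then show ?thesis using x by (auto simp: E_def)
    next
      case False
      then obtain y where y: "y \<in> J" "x < y" by (auto simp: not_le)
      then obtain r where r: "r \<in> \<rat>" "x < r" "r < y" using Rats_dense_in_real by blast
      then have "r \<in> J" using sub[OF x y(1)] by auto
      then show ?thesis using r by (auto simp: E_def)
    qed
    ultimately obtain a b where "a \<in> E" "b \<in> E" "a \<le> x" "x \<le> b" by blast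
    then show "x \<in> (\<Union>i\<in>E \<times> E. {fst i..snd i})"
      by (intro UN_I[of "(a, b)"]) auto
  qed
  moreover have "(\<Union>i\<in>E \<times> E. {fst i..snd i}) \<subseteq> J"
    using sub by (intro UN_least) (simp add: E_def mem_Times_iff)
  ultimately have J: "J = (\<Union>i\<in>E \<times> E. {fst i..snd i})" by blast
  have "cis ` J = (\<Union>i\<in>E \<times> E. cis ` {fst i..snd i})"
    by (subst J) (rule image_UN)
  also have "\<dots> \<in> sets borel"
  proof (rule sets.countable_UN')
    show "countable (E \<times> E)" using E by simp
    have "compact (cis ` {a..b})" for a b
      by (intro compact_continuous_image) (auto intro!: continuous_intros)
    then show "(\<lambda>i. cis ` {fst i..snd i}) ` (E \<times> E) \<subseteq> sets borel"
      by (intro image_subsetI borel_closed compact_imp_closed)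
  qed
  finally show ?thesis .
qed

definition arc_angles :: "complex set \<Rightarrow> real set" where
  "arc_angles I = {t \<in> {0..<2 * pi}. cis t \<in> I}"

lemma arc_length_eq: "arc_length I = measure lborel (arc_angles I) / (2 * pi)"
  by (simp add: arc_length_def arc_angles_def)

lemma arc_angles_fmeasurable:
  assumes "is_interval J"
  shows "arc_angles (cis ` J) \<in> fmeasurable lborel"
proof (rule fmeasurableI2[of "{0..2 * pi}"])
  have [measurable]: "cis \<in> borel_measurable borel"
    by (intro borel_measurable_continuous_onI continuous_intros)
  note [measurable] = borel_cis_image[OF assms]
  have "arc_angles (cis ` J) = {t \<in> space lborel. t \<in> {0..<2 * pi} \<and> cis t \<in> cis ` J}"
    by (auto simp: arc_angles_def)
  also have "\<dots> \<in> sets lborel" by measurable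
  finally show "arc_angles (cis ` J) \<in> sets lborel" .
  show "{0..2 * pi} \<in> fmeasurable lborel"
    by (simp add: fmeasurable_def)
  show "arc_angles (cis ` J) \<subseteq> {0..2 * pi}"
    unfolding arc_angles_def by (auto simp del: image_iff)
qed

lemma arc_length_le_1:
  assumes "is_interval J"
  shows "arc_length (cis ` J) \<le> 1"
proof -
  have "measure lborel (arc_angles (cis ` J)) \<le> measure lborel {0..2 * pi}"
  proof (rule measure_mono_fmeasurable)
    show "arc_angles (cis ` J) \<subseteq> {0..2 * pi}"
      unfolding arc_angles_def by (auto simp del: image_iff)
    show "arc_angles (cis ` J) \<in> sets lborel"
      using arc_angles_fmeasurable[OF assms] by (rule fmeasurableD)
  qed (simp add: fmeasurable_def)
  then show ?thesis
    by (simp add: arc_length_eq)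
qed

lemma turn_decomposition:
  fixes x :: real
  obtains k :: int where "2 * pi * k \<le> x" "x < 2 * pi * k + 2 * pi"
proof (rule that[of "\<lfloor>x / (2 * pi)\<rfloor>"])
  show "2 * pi * \<lfloor>x / (2 * pi)\<rfloor> \<le> x"
    using floor_divide_lower[of "2 * pi" x] by (simp add: mult.commute)
  show "x < 2 * pi * \<lfloor>x / (2 * pi)\<rfloor> + 2 * pi"
    using floor_divide_upper[of "2 * pi" x] by (simp add: algebra_simps)
qed

lemma cis_add_turns: "cis (t + 2 * pi * of_int k) = cis t"
  using sin_cos_eq_iff[of "t + 2 * pi * k" t] by (auto simp: complex_eq_iff)

text \<open>The constant is not sharp: only the longer of the two pieces into which a multiple of \<open>2 * pi\<close> cuts
the segment is used, which avoids adding lengths.\<close>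

lemma arc_length_ge:
  assumes J: "is_interval J" "{x..y} \<subseteq> J" and xy: "x \<le> y"
  shows "min (y - x) (2 * pi) \<le> 4 * pi * arc_length (cis ` J)"
proof -
  define l where "l = min (y - x) (2 * pi)"
  have l: "0 \<le> l" "x + l \<le> y" "l \<le> 2 * pi" using xy by (auto simp: l_def)
  obtain k :: int where k: "2 * pi * k \<le> x" "x < 2 * pi * k + 2 * pi"
    using turn_decomposition .
  have in_arc: "cis t \<in> cis ` J" if "t + 2 * pi * of_int j \<in> J" for t and j :: int
    using that cis_add_turns[of t j] by (metis imageI)
  \<comment> \<open>The next multiple \<open>2 * pi * (k + 1)\<close> of a full turn lies either in the second half of the segment
    or beyond it, or in the first half.\<close>
  have "\<exists>a. {a..<a + l / 2} \<subseteq> arc_angles (cis ` J)"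
  proof (cases "l / 2 \<le> 2 * pi * k + 2 * pi - x")
    case True
    have "{x - 2 * pi * k..<x - 2 * pi * k + l / 2} \<subseteq> arc_angles (cis ` J)"
    proof
      fix t assume t: "t \<in> {x - 2 * pi * k..<x - 2 * pi * k + l / 2}"
      then have "t + 2 * pi * k \<in> J"
        using l by (intro subsetD[OF J(2)]) auto
      then show "t \<in> arc_angles (cis ` J)"
        using t True k l in_arc[of t k] by (auto simp: arc_angles_def)
    qed
    then show ?thesis by blast
  next
    case False
    have "{0..<0 + l / 2} \<subseteq> arc_angles (cis ` J)"
    proof
      fix t assume t: "t \<in> {0..<0 + l / 2}"
      have "x \<le> t + 2 * pi * (k + 1)" "t + 2 * pi * (k + 1) \<le> y"
        using t k False l by (auto simp: algebra_simps)
      then have "t + 2 * pi * of_int (k + 1) \<in> J"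
        by (intro subsetD[OF J(2)]) (simp add: mult.commute)
      then show "t \<in> arc_angles (cis ` J)"
        using t l in_arc[of t "k + 1"] by (auto simp: arc_angles_def)
    qed
    then show ?thesis by blast
  qed
  then obtain a where a: "{a..<a + l / 2} \<subseteq> arc_angles (cis ` J)" by blast
  have "measure lborel {a..<a + l / 2} \<le> measure lborel (arc_angles (cis ` J))"
    by (rule measure_mono_fmeasurable[OF a _ arc_angles_fmeasurable[OF J(1)]]) simp
  then have "l / 2 \<le> measure lborel (arc_angles (cis ` J))"
    using l by simp
  then show ?thesis
    by (simp add: arc_length_eq flip: l_def)
qed

text \<open>Again up to a factor of 2: when \<open>y - x < 2 * pi\<close>, every angle of the arc in \<open>{0..<2 * pi}\<close> is the
translate of a point of \<open>{x..y}\<close> by one of only two multiples of \<open>2 * pi\<close>, and both translates of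
the whole segment are counted.\<close>

lemma arc_length_le:
  assumes J: "is_interval J" "J \<subseteq> {x..y}" and xy: "x \<le> y"
  shows "pi * arc_length (cis ` J) \<le> y - x"
proof (cases "y - x < 2 * pi")
  case False
  moreover have "pi * arc_length (cis ` J) \<le> pi"
    using arc_length_le_1[OF J(1)] by simp
  ultimately show ?thesis
    using pi_gt_zero by linarith
next
  case True
  obtain k :: int where k: "2 * pi * k \<le> x" "x < 2 * pi * k + 2 * pi"
    using turn_decomposition .
  let ?A = "{x - 2 * pi * k..y - 2 * pi * k}" and ?B = "{x - 2 * pi * (k + 1)..y - 2 * pi * (k + 1)}"
  have "arc_angles (cis ` J) \<subseteq> ?A \<union> ?B"
  proof
    fix t assume "t \<in> arc_angles (cis ` J)"
    then obtain s where s: "s \<in> J" "cis t = cis s" "0 \<le> t" "t < 2 * pi"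
      by (auto simp: arc_angles_def)
    then obtain j :: int where j: "t = s + 2 * pi * j"
      using sin_cos_eq_iff[of t s] by (auto simp: complex_eq_iff)
    have s': "x \<le> s" "s \<le> y" using s J(2) by auto
    have js: "2 * pi * (j + k) < 2 * pi * 1" "2 * pi * (- 2) < 2 * pi * (j + k)"
      using s s' j k True by (simp_all add: algebra_simps)
    have pi2: "0 < 2 * pi" by simp
    from js have "real_of_int (j + k) < 1" "- 2 < real_of_int (j + k)"
      by (simp_all only: mult_less_cancel_left_pos[OF pi2])
    then have "j = - k \<or> j = - (k + 1)" by linarith
    then have "t \<in> ?A \<or> t \<in> ?B"
      using s' j by (elim disjE) (simp_all add: algebra_simps)
    then show "t \<in> ?A \<union> ?B"
      by (simp only: Un_iff)
  qed
  then have "measure lborel (arc_angles (cis ` J)) \<le> measure lborel (?A \<union> ?B)"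
  proof (rule measure_mono_fmeasurable)
    show "arc_angles (cis ` J) \<in> sets lborel"
      using arc_angles_fmeasurable[OF J(1)] by (rule fmeasurableD)
    show "?A \<union> ?B \<in> fmeasurable lborel"
      by (intro fmeasurable.Un) (simp_all add: fmeasurable_def emeasure_lborel_Icc_eq)
  qed
  also have "\<dots> \<le> measure lborel ?A + measure lborel ?B"
    by (rule measure_Un_le) auto
  also have "\<dots> = 2 * (y - x)" using xy by simp
  finally show ?thesis
    by (simp add: arc_length_eq)
qed

lemma norm_cis_diff_le: "norm (cis a - cis b) \<le> \<bar>a - b\<bar>"
proof -
  have "cis a - cis b = cis b * (cis (a - b) - 1)"
    by (simp add: cis_mult algebra_simps)
  then have "norm (cis a - cis b) = norm (exp (\<i> * of_real (a - b)) - 1)"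
    by (simp add: norm_mult cis_conv_exp)
  also have "\<dots> = 2 * \<bar>sin ((a - b) / 2)\<bar>"
    by (rule dist_exp_i_1)
  also have "\<dots> \<le> \<bar>a - b\<bar>"
    using abs_sin_x_le_abs_x[of "(a - b) / 2"] by simp
  finally show ?thesis .
qed

lemma arc_diameter:
  assumes "I \<in> arcs" "u \<in> I" "v \<in> I"
  shows "norm (u - v) \<le> 4 * pi * arc_length I"
proof -
  obtain J where J: "is_interval J" "I = cis ` J"
    using assms by (auto simp: arcs_def)
  obtain a b where ab: "a \<in> J" "b \<in> J" "u = cis a" "v = cis b"
    using assms J by auto
  have "{min a b..max a b} \<subseteq> J"
    using is_interval_atLeastAtMost_subset[OF J(1), of a b]
      is_interval_atLeastAtMost_subset[OF J(1), of b a] ab(1,2)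
    unfolding min_def max_def by presburger
  then have "min (max a b - min a b) (2 * pi) \<le> 4 * pi * arc_length I"
    unfolding J(2) by (rule arc_length_ge[OF J(1)]) simp
  moreover have "norm (u - v) \<le> \<bar>a - b\<bar>"
    unfolding ab by (rule norm_cis_diff_le)
  moreover have "norm (u - v) \<le> 2"
    using norm_triangle_ineq4[of u v] by (simp add: ab)
  moreover have "2 \<le> 2 * pi" using pi_ge_two by simp
  moreover have "max a b - min a b = \<bar>a - b\<bar>" by (simp add: max_def min_def)
  ultimately have "norm (u - v) \<le> min (max a b - min a b) (2 * pi)" "min (max a b - min a b) (2 * pi) \<le> 4 * pi * arc_length I"
    by simp_all
  then show ?thesis by (rule order_trans)
qed

lemma arc_length_bounds:
  assumes "I \<in> arcs"
  shows "0 < arc_length I" "arc_length I \<le> 1"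
  using assms arc_length_le_1 by (auto simp: arcs_def)

text \<open>If \<open>J\<close> stayed within distance \<open>L\<close> of one of its points, its arc would have length at most
\<open>2 * L / pi\<close>, which is smaller than \<open>L\<close>; so \<open>J\<close> contains a segment of length \<open>L\<close>, and \<open>\<theta>\<close> is its
midpoint.\<close>

lemma arc_contains_length:
  assumes "I \<in> arcs"
  obtains \<theta> where "\<And>t. \<bar>t - \<theta>\<bar> \<le> arc_length I / 2 \<Longrightarrow> cis t \<in> I"
proof -
  obtain J where J: "is_interval J" "I = cis ` J"
    using assms by (auto simp: arcs_def)
  define L where "L = arc_length I"
  have L: "0 < L" using arc_length_bounds[OF assms] by (simp add: L_def)
  have "I \<noteq> {}"
  proof
    assume "I = {}"
    then have "L = 0" by (simp add: L_def arc_length_def)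
    then show False using L by simp
  qed
  then obtain a where a: "a \<in> J" using J by auto
  have "\<exists>b\<in>J. L < \<bar>b - a\<bar>"
  proof (rule ccontr)
    assume "\<not> ?thesis"
    then have "J \<subseteq> {a - L..a + L}" by (force simp: abs_le_iff not_less)
    then have "pi * L \<le> (a + L) - (a - L)"
      unfolding L_def J(2) by (rule arc_length_le[OF J(1)]) (use L L_def J in auto)
    then have "pi * L \<le> 2 * L" by simp
    then have "pi \<le> 2" using L by simp
    then show False using pi_gt3 by simp
  qed
  then obtain b where b: "b \<in> J" "L < \<bar>b - a\<bar>" by blast
  have "t \<in> J" if "\<bar>t - (a + b) / 2\<bar> \<le> L / 2" for t
  proof -
    have "min a b \<le> t" "t \<le> max a b"
      using that b(2) by (auto simp: abs_if min_def max_def field_simps split: if_splits)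
    then show ?thesis
      using is_interval_atLeastAtMost_subset[OF J(1), of "min a b" "max a b"] a b(1)
      unfolding min_def max_def by (cases "a \<le> b") (simp_all add: subset_iff)
  qed
  then show thesis
    using that[of "(a + b) / 2"] J unfolding L_def by blast
qed

lemma arctan_le_self:
  assumes "0 \<le> x"
  shows "arctan x \<le> x"
proof -
  have "0 - arctan 0 \<le> x - arctan x"
  proof (rule DERIV_nonneg_imp_nondecreasing[OF assms])
    fix t :: real
    have "((\<lambda>x. x - arctan x) has_real_derivative 1 - inverse (1 + t\<^sup>2)) (at t)"
      by (auto intro!: derivative_eq_intros)
    moreover have "0 \<le> 1 - inverse (1 + t\<^sup>2)"
      by (simp add: inverse_le_1_iff)
    ultimately show "\<exists>y. ((\<lambda>x. x - arctan x) has_real_derivative y) (at t) \<and> 0 \<le> y"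
      by blast
  qed
  then show ?thesis by simp
qed

text \<open>A relative perturbation of size \<open>\<epsilon> \<le> 1 / 2\<close> turns the direction of a complex number by at most
\<open>2 * \<epsilon>\<close>. This is what decides whether a point lies above a given arc.\<close>

lemma direction_perturbation:
  fixes z \<zeta> :: complex
  assumes z: "z \<noteq> 0" and close: "norm (\<zeta> - z) \<le> norm z / 2"
  obtains \<phi> where "\<bar>\<phi>\<bar> \<le> 2 * norm (\<zeta> - z) / norm z" "\<zeta> \<noteq> 0" "\<zeta> / of_real (norm \<zeta>) = cis (Arg z + \<phi>)"
proof -
  define w where "w = \<zeta> / z"
  have w1: "w - 1 = (\<zeta> - z) / z" using z by (simp add: w_def field_simps)
  have u: "norm (w - 1) = norm (\<zeta> - z) / norm z" unfolding w1 by (simp add: norm_divide)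
  have u2: "norm (w - 1) \<le> 1 / 2" unfolding u using close z by (simp add: divide_le_eq)
  have Re: "1 / 2 \<le> Re w"
    using abs_Re_le_cmod[of "w - 1"] u2 by simp
  have Im: "\<bar>Im w\<bar> \<le> norm (w - 1)"
    using abs_Im_le_cmod[of "w - 1"] by simp
  have "w \<noteq> 0" using Re by auto
  then have \<zeta>0: "\<zeta> \<noteq> 0" by (auto simp: w_def)
  have "\<bar>Arg w\<bar> = arctan \<bar>Im w / Re w\<bar>"
    using Re by (simp add: arg_conv_arctan abs_arctan)
  also have "\<dots> \<le> \<bar>Im w / Re w\<bar>" by (rule arctan_le_self) simp
  also have "\<dots> = \<bar>Im w\<bar> / Re w" using Re by simp
  also have "\<dots> \<le> norm (w - 1) / (1 / 2)"
    using Re Im by (intro frac_le) auto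
  finally have "\<bar>Arg w\<bar> \<le> 2 * norm (\<zeta> - z) / norm z" unfolding u by (simp add: mult.commute)
  moreover have "\<zeta> / of_real (norm \<zeta>) = cis (Arg z + Arg w)"
  proof -
    have "cis (Arg z + Arg w) = sgn z * sgn w"
      using z \<open>w \<noteq> 0\<close> by (simp add: cis_Arg flip: cis_mult)
    also have "\<dots> = sgn (z * w)"
      by (simp add: sgn_mult)
    also have "z * w = \<zeta>" using z by (simp add: w_def)
    finally show ?thesis by (simp add: sgn_eq)
  qed
  ultimately show thesis using that \<zeta>0 by blast
qed

lemma carleson_box_sets:
  assumes "I \<in> arcs"
  shows "carleson_box I \<in> sets disk_area"
proof -
  obtain J where J: "is_interval J" "I = cis ` J"
    using assms by (auto simp: arcs_def)
  note [measurable] = borel_measurable_ident_disk borel_cis_image[OF J(1)]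
  have "carleson_box I = {z \<in> space disk_area.
      z / of_real (norm z) \<in> cis ` J \<and> 1 - arc_length I < norm z \<and> norm z < 1}"
    by (auto simp: carleson_box_def J(2))
  also have "\<dots> \<in> sets disk_area" by measurable
  finally show ?thesis .
qed

lemma carleson_box_subset_ball:
  assumes I: "I \<in> arcs" and u: "u \<in> I"
  shows "carleson_box I \<subseteq> ball (of_real (1 - arc_length I / 2) * u) (16 * arc_length I)"
proof
  fix z assume z: "z \<in> carleson_box I"
  define L where "L = arc_length I"
  note L = arc_length_bounds[OF I, folded L_def]
  define v where "v = z / of_real (norm z)"
  have v: "v \<in> I" "1 - L < norm z" "norm z < 1"
    using z by (auto simp: carleson_box_def v_def L_def)
  have zv: "z = of_real (norm z) * v" by (simp add: v_def)
  have nu: "norm u = 1" using u I by (auto simp: arcs_def)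
  have "of_real (1 - L / 2) * u - z = of_real (1 - L / 2 - norm z) * u + of_real (norm z) * (u - v)"
    by (subst (1) zv) (simp add: algebra_simps)
  then have "norm (of_real (1 - L / 2) * u - z) \<le> norm (of_real (1 - L / 2 - norm z) * u) + norm (of_real (norm z) * (u - v))"
    by (simp only: norm_triangle_ineq)
  also have "\<dots> = \<bar>1 - L / 2 - norm z\<bar> + norm z * norm (u - v)"
    unfolding norm_mult norm_of_real nu by simp
  also have "\<dots> \<le> L / 2 + norm (u - v)"
  proof (rule add_mono)
    show "\<bar>1 - L / 2 - norm z\<bar> \<le> L / 2"
      unfolding abs_le_iff using v by linarith
    show "norm z * norm (u - v) \<le> norm (u - v)"
      using v by (simp add: mult_left_le_one_le)
  qed
  also have "norm (u - v) \<le> 4 * pi * L"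
    unfolding L_def by (rule arc_diameter[OF I u v(1)])
  also have "4 * pi * L < 15 * L"
    using L pi_less_4 pi_approx by (intro mult_strict_right_mono) auto
  finally show "z \<in> ball (of_real (1 - arc_length I / 2) * u) (16 * arc_length I)"
    using L by (simp add: dist_norm L_def)
qed

lemma ball_subset_carleson_box:
  assumes I: "I \<in> arcs"
  obtains c where "ball c (arc_length I / 16) \<subseteq> carleson_box I"
proof -
  define L where "L = arc_length I"
  note L = arc_length_bounds[OF I, folded L_def]
  obtain \<theta> where \<theta>: "\<And>t. \<bar>t - \<theta>\<bar> \<le> L / 2 \<Longrightarrow> cis t \<in> I"
    using arc_contains_length[OF I] unfolding L_def by blast
  define c where "c = rcis (1 - L / 2) \<theta>"
  have nc: "norm c = 1 - L / 2" using L by (simp add: c_def)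
  have c0: "c \<noteq> 0" using nc L by auto
  have "cis (Arg c) = cis \<theta>"
  proof -
    have "c = of_real (norm c) * cis \<theta>"
      unfolding nc by (simp add: c_def rcis_def)
    then have "c / of_real (norm c) = cis \<theta>"
      using c0 by (simp add: divide_eq_eq mult.commute)
    then show ?thesis
      by (simp add: cis_Arg[OF c0] sgn_eq)
  qed
  have "ball c (L / 16) \<subseteq> carleson_box I"
  proof
    fix z assume "z \<in> ball c (L / 16)"
    then have z: "norm (z - c) < L / 16" by (simp add: dist_norm norm_minus_commute)
    have nz: "\<bar>norm z - norm c\<bar> < L / 16"
      using norm_triangle_ineq3[of z c] z by linarith
    have "norm (z - c) \<le> norm c / 2" using z nc L by linarith
    from direction_perturbation[OF c0 this] obtain \<phi> where
      \<phi>: "\<bar>\<phi>\<bar> \<le> 2 * norm (z - c) / norm c" "z / of_real (norm z) = cis (Arg c + \<phi>)" by metis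
    have "2 * norm (z - c) / norm c \<le> 2 * (L / 16) / (1 / 2)"
      using z nc L by (intro frac_le) auto
    then have "cis (\<theta> + \<phi>) \<in> I"
      using \<phi>(1) L by (intro \<theta>) auto
    moreover have "cis (Arg c + \<phi>) = cis (\<theta> + \<phi>)"
      by (simp add: \<open>cis (Arg c) = cis \<theta>\<close> flip: cis_mult)
    moreover have "norm z < 1" "1 - L < norm z"
      using nz L unfolding nc abs_less_iff by linarith+
    ultimately show "z \<in> carleson_box I"
      using \<phi>(2) by (simp add: carleson_box_def L_def[symmetric])
  qed
  then show thesis using that unfolding L_def by blast
qed

text \<open>The converse comparison to \<open>carleson_box_subset_ball\<close>: a disk that reaches the boundary lies in a
box of comparable size.\<close>

lemma disk_ball_subset_carleson_box:
  assumes z: "z \<in> unit_disk" "1 - norm z \<le> d" "d \<le> 1 / 8"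
  obtains I where "I \<in> arcs" "ball z d \<inter> unit_disk \<subseteq> carleson_box I" "arc_length I \<le> 16 * d"
proof -
  have d: "0 < d" "d \<le> 1 / 8" "7 / 8 \<le> norm z" using z by auto
  have z0: "z \<noteq> 0" using d by auto
  \<comment> \<open>The points of the ball have depth below \<open>2 * d\<close>, which must stay below the length of the arc; a
    half-angle of \<open>16 * d\<close> achieves this in spite of the lossy constant in \<open>arc_length_ge\<close>.\<close>
  define J where "J = {Arg z - 16 * d..Arg z + 16 * d}"
  define L where "L = arc_length (cis ` J)"
  have J: "is_interval J" by (simp add: J_def is_interval_cc)
  have "min ((Arg z + 16 * d) - (Arg z - 16 * d)) (2 * pi) \<le> 4 * pi * L"
    unfolding L_def by (rule arc_length_ge[OF J]) (use d in \<open>auto simp: J_def\<close>)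
  moreover have "32 * d \<le> 2 * pi" using d pi_gt3 by simp
  ultimately have "32 * d \<le> 4 * pi * L" by simp
  then have L8: "8 * d \<le> pi * L" by linarith
  also have "pi * L \<le> 4 * L"
    using pi_less_4 by (intro mult_right_mono) (auto simp: L_def arc_length_def)
  finally have L2: "2 * d \<le> L" by simp
  have L4: "2 * d < L"
  proof (rule ccontr)
    assume "\<not> ?thesis"
    then have "L = 2 * d" using L2 by simp
    then show False using L8 pi_less_4 d by simp
  qed
  have "pi * L \<le> (Arg z + 16 * d) - (Arg z - 16 * d)"
    unfolding L_def by (rule arc_length_le[OF J]) (use d in \<open>auto simp: J_def\<close>)
  moreover have "2 * L \<le> pi * L" using L4 d pi_ge_two by (intro mult_right_mono) auto
  ultimately have L16: "L \<le> 16 * d" by simp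
  show thesis
  proof (rule that)
    show "cis ` J \<in> arcs" using J L4 d by (auto simp: arcs_def L_def)
    show "arc_length (cis ` J) \<le> 16 * d" using L16 by (simp add: L_def)
    show "ball z d \<inter> unit_disk \<subseteq> carleson_box (cis ` J)"
    proof
      fix \<zeta> assume "\<zeta> \<in> ball z d \<inter> unit_disk"
      then have \<zeta>: "norm (\<zeta> - z) < d" "norm \<zeta> < 1" by (auto simp: dist_norm norm_minus_commute)
      have "norm (\<zeta> - z) \<le> norm z / 2" using \<zeta> d by linarith
      from direction_perturbation[OF z0 this] obtain \<phi> where
        \<phi>: "\<bar>\<phi>\<bar> \<le> 2 * norm (\<zeta> - z) / norm z" "\<zeta> / of_real (norm \<zeta>) = cis (Arg z + \<phi>)" by metis
      have "2 * norm (\<zeta> - z) / norm z \<le> 2 * d / (1 / 2)"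
        using \<zeta> d by (intro frac_le) auto
      then have "Arg z + \<phi> \<in> J"
        using \<phi>(1) d by (auto simp: J_def)
      moreover have "1 - L < norm \<zeta>"
        using norm_triangle_ineq3[of \<zeta> z] \<zeta> z L4 by linarith
      ultimately show "\<zeta> \<in> carleson_box (cis ` J)"
        using \<phi>(2) \<zeta> by (auto simp: carleson_box_def L_def)
    qed
  qed
qed

text \<open>The box of the whole circle serves the disks that are too large for an arc; it omits only the
origin.\<close>

lemma circle_arc:
  "cis ` UNIV \<in> arcs" "unit_disk - {0} \<subseteq> carleson_box (cis ` UNIV)" "arc_length (cis ` UNIV) = 1"
proof -
  have "{t \<in> {0..<2 * pi}. cis t \<in> range cis} = {0..<2 * pi}" by auto
  then show L: "arc_length (cis ` UNIV) = 1" by (simp add: arc_length_def)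
  then show "cis ` UNIV \<in> arcs"
    using is_interval_univ by (force simp: arcs_def)
  show "unit_disk - {0} \<subseteq> carleson_box (cis ` UNIV)"
  proof
    fix z :: complex assume z: "z \<in> unit_disk - {0}"
    then have "z / of_real (norm z) = cis (Arg z)" by (simp add: cis_Arg sgn_eq)
    then show "z \<in> carleson_box (cis ` UNIV)"
      using z L by (auto simp: carleson_box_def)
  qed
qed

lemma disk_area_ball:
  assumes "0 \<le> r"
  shows "ball c r \<subseteq> unit_disk \<Longrightarrow> measure disk_area (ball c r) = r\<^sup>2"
    and "measure disk_area (ball c r \<inter> unit_disk) \<le> r\<^sup>2"
proof -
  have eq: "measure disk_area A = measure lebesgue A / pi" if "A \<in> sets lebesgue" "A \<subseteq> unit_disk" for A
  proof -
    have "emeasure disk_area A = ennreal (1 / pi) * emeasure (lebesgue_on unit_disk) A"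
      unfolding disk_area_def using that
      by (subst emeasure_density_const) (auto simp: sets_restrict_space_iff)
    also have "emeasure (lebesgue_on unit_disk) A = emeasure lebesgue A"
      using that by (intro emeasure_restrict_space) auto
    finally show ?thesis
      by (simp add: measure_def enn2real_mult)
  qed
  have ball: "measure lebesgue (ball c r) = pi * r\<^sup>2"
    using content_ball[OF assms, of c] unit_ball_vol_2 by simp
  show "measure disk_area (ball c r) = r\<^sup>2" if "ball c r \<subseteq> unit_disk"
    using eq[OF _ that] ball by simp
  have "measure lebesgue (ball c r \<inter> unit_disk) \<le> measure lebesgue (ball c r)"
    by (rule measure_mono_fmeasurable) auto
  then show "measure disk_area (ball c r \<inter> unit_disk) \<le> r\<^sup>2"
    using eq[of "ball c r \<inter> unit_disk"] ball by (simp add: divide_le_eq mult.commute)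
qed

lemma carleson_box_area:
  assumes "I \<in> arcs"
  shows "(arc_length I / 16)\<^sup>2 \<le> measure disk_area (carleson_box I)"
    and "measure disk_area (carleson_box I) \<le> (16 * arc_length I)\<^sup>2"
proof -
  interpret finite_measure disk_area by (rule finite_measure_disk_area)
  note L = arc_length_bounds[OF assms]
  note Q = carleson_box_sets[OF assms]
  obtain c where c: "ball c (arc_length I / 16) \<subseteq> carleson_box I"
    using ball_subset_carleson_box[OF assms] .
  then have "ball c (arc_length I / 16) \<subseteq> unit_disk"
    by (auto simp: carleson_box_def)
  then have "measure disk_area (ball c (arc_length I / 16)) = (arc_length I / 16)\<^sup>2"
    using L by (intro disk_area_ball) auto
  then show "(arc_length I / 16)\<^sup>2 \<le> measure disk_area (carleson_box I)"
    using finite_measure_mono[OF c Q] by simp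
  have "carleson_box I \<noteq> {}"
    using c L by auto
  then obtain u where "u \<in> I" by (auto simp: carleson_box_def)
  then obtain c' where "carleson_box I \<subseteq> ball c' (16 * arc_length I) \<inter> unit_disk"
    using carleson_box_subset_ball[OF assms] by (fastforce simp: carleson_box_def)
  then have "measure disk_area (carleson_box I) \<le> measure disk_area (ball c' (16 * arc_length I) \<inter> unit_disk)"
    by (intro finite_measure_mono disk_ball_sets)
  also have "\<dots> \<le> (16 * arc_length I)\<^sup>2"
    using L by (intro disk_area_ball) auto
  finally show "measure disk_area (carleson_box I) \<le> (16 * arc_length I)\<^sup>2" .
qed

section \<open>Doubling weights as doubling measures\<close>

abbreviation weighted_measure :: "(complex \<Rightarrow> real) \<Rightarrow> complex measure" where
  "weighted_measure \<omega> \<equiv> density disk_area (\<lambda>z. ennreal (\<omega> z))"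

lemma weighted_area_eq_measure:
  assumes "weight \<omega>" "A \<in> sets disk_area"
  shows "weighted_area \<omega> A = measure (weighted_measure \<omega>) A"
proof -
  have [measurable]: "\<omega> \<in> borel_measurable disk_area" "A \<in> sets disk_area"
    using assms by (auto simp: weight_def)
  have pos: "0 < \<omega> z" if "z \<in> space disk_area" for z
    using that assms(1) by (simp add: weight_def)
  have "weighted_area \<omega> A = enn2real (\<integral>\<^sup>+z. ennreal (indicator A z *\<^sub>R \<omega> z) \<partial>disk_area)"
    unfolding weighted_area_def set_lebesgue_integral_def
    by (rule integral_eq_nn_integral)
      (auto intro!: AE_I2 mult_nonneg_nonneg less_imp_le[OF pos])
  also have "(\<integral>\<^sup>+z. ennreal (indicator A z *\<^sub>R \<omega> z) \<partial>disk_area) = (\<integral>\<^sup>+z. ennreal (\<omega> z) * indicator A z \<partial>disk_area)"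
    by (rule nn_integral_cong) (simp split: split_indicator)
  also have "\<dots> = emeasure (weighted_measure \<omega>) A"
    by (rule emeasure_density[symmetric]) measurable
  finally show ?thesis by (simp add: measure_def)
qed

lemma finite_weighted_measure:
  assumes "weight \<omega>"
  shows "finite_measure (weighted_measure \<omega>)"
proof
  have [measurable]: "\<omega> \<in> borel_measurable disk_area" and int: "integrable disk_area \<omega>"
    using assms by (auto simp: weight_def)
  have "emeasure (weighted_measure \<omega>) (space (weighted_measure \<omega>)) = (\<integral>\<^sup>+z. ennreal (\<omega> z) \<partial>disk_area)"
    using sets.top[of disk_area]
    by (subst emeasure_density) (auto intro!: nn_integral_cong split: split_indicator)
  also have "\<dots> \<le> (\<integral>\<^sup>+z. ennreal (norm (\<omega> z)) \<partial>disk_area)"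
    by (intro nn_integral_mono ennreal_leI) simp
  also have "\<dots> < \<infinity>"
    using int by (simp add: integrable_iff_bounded)
  finally show "emeasure (weighted_measure \<omega>) (space (weighted_measure \<omega>)) \<noteq> \<infinity>" by simp
qed

text \<open>The disk \<open>B(z, r)\<close> contains a full disk of positive radius, hence is not a null set, and the
weight is positive everywhere on it.\<close>

lemma weighted_measure_ball_pos:
  assumes \<omega>: "weight \<omega>" and z: "z \<in> unit_disk" and r: "0 < r"
  shows "0 < measure (weighted_measure \<omega>) (ball z r \<inter> unit_disk)"
proof -
  interpret finite_measure "weighted_measure \<omega>" by (rule finite_weighted_measure[OF \<omega>])
  have [measurable]: "\<omega> \<in> borel_measurable disk_area" using \<omega> by (auto simp: weight_def)
  note [measurable] = disk_ball_sets
  define e where "e = min r (1 - norm z)"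
  have e: "0 < e" using z r by (simp add: e_def)
  have "ball z e \<subseteq> ball 0 1"
  proof -
    have "norm z + e \<le> 1"
      using min.cobounded2[of r "1 - norm z"] unfolding e_def by linarith
    then show ?thesis by (simp add: ball_subset_ball_iff)
  qed
  then have "measure disk_area (ball z e) = e\<^sup>2"
    using disk_area_ball(1)[of e z] e by simp
  moreover have sub: "ball z e \<subseteq> ball z r \<inter> unit_disk"
    using \<open>ball z e \<subseteq> ball 0 1\<close> by (auto simp: e_def)
  ultimately have not_null: "ball z r \<inter> unit_disk \<notin> null_sets disk_area"
  proof (intro notI)
    assume "measure disk_area (ball z e) = e\<^sup>2" "ball z r \<inter> unit_disk \<in> null_sets disk_area"
    moreover have "ball z e \<in> sets disk_area"
      using disk_ball_sets[of z e] sub by (metis Int_absorb2 Int_lower2 order_trans)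
    ultimately have "ball z e \<in> null_sets disk_area"
      using sub by (meson null_sets_subset)
    then have "measure disk_area (ball z e) = 0"
      by (simp add: measure_def null_setsD1)
    then show False using \<open>measure disk_area (ball z e) = e\<^sup>2\<close> e by simp
  qed
  have "measure (weighted_measure \<omega>) (ball z r \<inter> unit_disk) \<noteq> 0"
  proof
    assume "measure (weighted_measure \<omega>) (ball z r \<inter> unit_disk) = 0"
    then have "ball z r \<inter> unit_disk \<in> null_sets (weighted_measure \<omega>)"
      using disk_ball_sets by (intro null_setsI) (auto simp: emeasure_eq_measure)
    then have "AE x in disk_area. x \<in> ball z r \<inter> unit_disk \<longrightarrow> ennreal (\<omega> x) = 0"
      by (subst (asm) null_sets_density_iff) auto
    moreover have "ennreal (\<omega> x) \<noteq> 0" if "x \<in> unit_disk" for x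
      using \<omega> that by (simp add: weight_def ennreal_eq_0_iff not_le)
    ultimately have "AE x in disk_area. x \<notin> ball z r \<inter> unit_disk"
      by (auto elim!: eventually_mono)
    then show False
      using not_null AE_iff_null_sets[OF disk_ball_sets] by blast
  qed
  then show ?thesis by (simp add: zero_less_measure_iff)
qed

lemma doubling_weight_disk_measure:
  assumes "doubling_weight \<omega>"
  obtains C where "doubling_disk_measure (weighted_measure \<omega>) C"
proof -
  have \<omega>: "weight \<omega>" using assms by (simp add: doubling_weight_def)
  interpret finite_measure "weighted_measure \<omega>" by (rule finite_weighted_measure[OF \<omega>])
  obtain C where C: "0 < C" "\<And>z r. z \<in> unit_disk \<Longrightarrow> 0 < r \<Longrightarrow>
      emeasure (weighted_measure \<omega>) (ball z (2 * r) \<inter> unit_disk)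
      \<le> ennreal C * emeasure (weighted_measure \<omega>) (ball z r \<inter> unit_disk)"
    using assms by (auto simp: doubling_weight_def doubling_def)
  have "doubling_disk_measure (weighted_measure \<omega>) (max 1 C)"
  proof
    fix z :: complex and r :: real assume zr: "z \<in> unit_disk" "0 < r"
    show "0 < measure (weighted_measure \<omega>) (ball z r \<inter> unit_disk)"
      using weighted_measure_ball_pos[OF \<omega>] zr by blast
    have "ennreal (measure (weighted_measure \<omega>) (ball z (2 * r) \<inter> unit_disk))
        \<le> ennreal (C * measure (weighted_measure \<omega>) (ball z r \<inter> unit_disk))"
      using C(2)[OF zr] C(1) by (simp add: emeasure_eq_measure ennreal_mult)
    then have "measure (weighted_measure \<omega>) (ball z (2 * r) \<inter> unit_disk)
        \<le> C * measure (weighted_measure \<omega>) (ball z r \<inter> unit_disk)"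
      using C(1) by (simp add: ennreal_le_iff)
    also have "\<dots> \<le> max 1 C * measure (weighted_measure \<omega>) (ball z r \<inter> unit_disk)"
      by (intro mult_right_mono) auto
    finally show "measure (weighted_measure \<omega>) (ball z (2 * r) \<inter> unit_disk)
        \<le> max 1 C * measure (weighted_measure \<omega>) (ball z r \<inter> unit_disk)" .
  qed auto
  then show thesis by (rule that)
qed

section \<open>Measurability and size of the operator\<close>

text \<open>The cut-off by the right half-plane makes the complex power a Borel function on the whole plane, so
that it can be composed with \<open>1 - z * cnj w\<close> on the product space.\<close>

lemma borel_measurable_powr_right_half_plane:
  assumes "\<alpha> > 0"
  shows "(\<lambda>u::complex. indicator {u. 0 \<le> Re u} u *\<^sub>R (u powr complex_of_real \<alpha>)) \<in> borel_measurable borel"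
proof (rule borel_measurable_continuous_on_indicator)
  have "closed {u. 0 \<le> Re u}" by (rule closed_halfspace_Re_ge)
  then show "{u. 0 \<le> Re u} \<in> sets borel" by (rule borel_closed)
  show "continuous_on {u. 0 \<le> Re u} (\<lambda>u. u powr complex_of_real \<alpha>)"
    using assms by (intro continuous_on_powr_complex continuous_intros) auto
qed

lemma borel_measurable_kernel:
  assumes "\<alpha> > 0" "z \<in> unit_disk"
  shows "(\<lambda>w. (1 - z * cnj w) powr complex_of_real \<alpha>) \<in> borel_measurable disk_area"
proof -
  note [measurable] = borel_measurable_ident_disk borel_measurable_powr_right_half_plane[OF assms(1)]
  let ?h = "\<lambda>u. indicator {u. 0 \<le> Re u} u *\<^sub>R (u powr complex_of_real \<alpha>)"
  have "(1 - z * cnj w) powr complex_of_real \<alpha> = ?h (1 - z * cnj w)" if "w \<in> space disk_area" for w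
    using one_minus_mult_cnj_bounds(5)[of z w] assms that by (simp add: indicator_def)
  moreover have "(\<lambda>w. ?h (1 - z * cnj w)) \<in> borel_measurable disk_area"
    by (rule measurable_compose[OF _ borel_measurable_powr_right_half_plane[OF assms(1)]]) measurable
  ultimately show ?thesis
    using measurable_cong by (metis (no_types, lifting))
qed

lemma borel_measurable_K_op:
  assumes \<alpha>: "\<alpha> > 0" and f [measurable]: "f \<in> borel_measurable disk_area"
  shows "K_op \<alpha> f \<in> borel_measurable disk_area"
proof -
  interpret finite_measure disk_area by (rule finite_measure_disk_area)
  note [measurable] = borel_measurable_ident_disk
  let ?h = "\<lambda>u. indicator {u. 0 \<le> Re u} u *\<^sub>R (u powr complex_of_real \<alpha>)"
  have [measurable]: "?h \<in> borel_measurable borel"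
    by (rule borel_measurable_powr_right_half_plane[OF \<alpha>])
  have [measurable]: "(\<lambda>x. ?h (1 - fst x * cnj (snd x))) \<in> borel_measurable (disk_area \<Otimes>\<^sub>M disk_area)"
    by (rule measurable_compose[OF _ borel_measurable_powr_right_half_plane[OF \<alpha>]]) measurable
  have "(\<lambda>z. LINT w|disk_area. f w / ?h (1 - z * cnj w)) \<in> borel_measurable disk_area"
    by (rule borel_measurable_lebesgue_integral) (simp add: case_prod_beta')
  moreover have "K_op \<alpha> f z = (LINT w|disk_area. f w / ?h (1 - z * cnj w))" if "z \<in> space disk_area" for z
    unfolding K_op_def
  proof (rule Bochner_Integration.integral_cong)
    fix w assume "w \<in> space disk_area"
    then show "f w / (1 - z * cnj w) powr complex_of_real \<alpha> = f w / ?h (1 - z * cnj w)"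
      using one_minus_mult_cnj_bounds(5)[of z w] that by (simp add: indicator_def)
  qed simp
  ultimately show ?thesis
    using measurable_cong by (metis (no_types, lifting))
qed

lemma norm_integral_le_nn_integral:
  fixes g :: "'a \<Rightarrow> complex"
  shows "ennreal (norm (LINT w|M. g w)) \<le> (\<integral>\<^sup>+w. ennreal (norm (g w)) \<partial>M)"
  by (cases "integrable M g") (simp_all add: integral_norm_bound_ennreal not_integrable_integral_eq)

lemma norm_K_op_le:
  "ennreal (norm (K_op \<alpha> f z))
    \<le> (\<integral>\<^sup>+w. ennreal (norm (f w) * norm (1 - z * cnj w) powr - \<alpha>) \<partial>disk_area)"
proof -
  have "ennreal (norm (K_op \<alpha> f z)) \<le> (\<integral>\<^sup>+w. ennreal (norm (f w / (1 - z * cnj w) powr complex_of_real \<alpha>)) \<partial>disk_area)"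
    unfolding K_op_def by (rule norm_integral_le_nn_integral)
  also have "\<dots> = (\<integral>\<^sup>+w. ennreal (norm (f w) * norm (1 - z * cnj w) powr - \<alpha>) \<partial>disk_area)"
    by (simp add: norm_mult norm_inverse norm_powr_real_powr' powr_minus divide_inverse)
  finally show ?thesis .
qed

section \<open>From Carleson boxes to boundedness\<close>

text \<open>All boxes have positive area, so the quotients in the characteristic can be cleared.\<close>

lemma carleson_characteristic_finite_iff:
  "carleson_characteristic p \<alpha> \<omega> \<sigma> < \<infinity> \<longleftrightarrow> (\<exists>A. \<forall>I\<in>arcs.
     weighted_area \<omega> (carleson_box I) * weighted_area \<sigma> (carleson_box I) powr (p - 1)
     \<le> A * measure disk_area (carleson_box I) powr (p * \<alpha> / 2))" (is "?L \<longleftrightarrow> (\<exists>A. \<forall>I\<in>arcs. ?N I \<le> A * ?D I)")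
proof -
  have D: "0 < ?D I" if "I \<in> arcs" for I
  proof -
    have "0 < (arc_length I / 16)\<^sup>2" using arc_length_bounds[OF that] by simp
    then have "0 < measure disk_area (carleson_box I)"
      using carleson_box_area(1)[OF that] by linarith
    then show ?thesis by simp
  qed
  have char: "carleson_characteristic p \<alpha> \<omega> \<sigma> = (SUP I\<in>arcs. ereal (?N I / ?D I))"
    by (simp add: carleson_characteristic_def)
  show ?thesis
  proof
    assume L: ?L
    have "\<exists>A. \<forall>I\<in>arcs. ereal (?N I / ?D I) \<le> ereal A"
    proof (cases "carleson_characteristic p \<alpha> \<omega> \<sigma>")
      case (real r)
      then show ?thesis unfolding char by (metis (no_types, lifting) SUP_upper)
    next
      case PInf
      then show ?thesis using L by simp
    next
      case MInf
      then have "ereal (?N I / ?D I) \<le> - \<infinity>" if "I \<in> arcs" for I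
        unfolding char using that by (metis (no_types, lifting) SUP_upper)
      then have "I \<notin> arcs" for I by auto
      then show ?thesis by blast
    qed
    then obtain A where "\<forall>I\<in>arcs. ?N I / ?D I \<le> A" by auto
    then have "\<forall>I\<in>arcs. ?N I \<le> A * ?D I"
      using D by (simp add: pos_divide_le_eq)
    then show "\<exists>A. \<forall>I\<in>arcs. ?N I \<le> A * ?D I" ..
  next
    assume "\<exists>A. \<forall>I\<in>arcs. ?N I \<le> A * ?D I"
    then obtain A where "\<forall>I\<in>arcs. ?N I \<le> A * ?D I" ..
    then have "\<forall>I\<in>arcs. ereal (?N I / ?D I) \<le> ereal A"
      using D by (simp add: pos_divide_le_eq)
    then have "(SUP I\<in>arcs. ereal (?N I / ?D I)) \<le> ereal A"
      by (intro SUP_least) blast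
    then show ?L unfolding char by (rule le_less_trans) simp
  qed
qed

lemma power2_powr_half:
  fixes x a :: real
  assumes "0 < x"
  shows "(x\<^sup>2) powr (a / 2) = x powr a"
proof -
  have "x\<^sup>2 = x powr 2" using assms by simp
  then show ?thesis by (simp only: powr_powr) simp
qed

text \<open>The box condition is first carried over to all disks that reach the boundary; the Schur test then
applies to \<open>x z = norm (K_op \<alpha> f z)\<close>.\<close>

lemma carleson_box_sufficient:
  fixes \<alpha> p p' :: real and \<omega> \<sigma> :: "complex \<Rightarrow> real"
  assumes \<alpha>: "\<alpha> > 0" and pq: "p > 1" "p' > 1" "1 / p + 1 / p' = 1"
    and \<sigma>: "\<sigma> = dual_weight p' \<omega>"
    and doubling: "doubling_weight \<omega>" "doubling_weight \<sigma>"
    and A: "\<And>I. I \<in> arcs \<Longrightarrow>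
      weighted_area \<omega> (carleson_box I) * weighted_area \<sigma> (carleson_box I) powr (p - 1)
      \<le> A * measure disk_area (carleson_box I) powr (p * \<alpha> / 2)"
  shows "bounded_on_Lp p \<omega> (K_op \<alpha>)"
proof -
  let ?\<mu> = "weighted_measure \<omega>" and ?\<nu> = "weighted_measure \<sigma>"
  have weights: "weight \<omega>" "weight \<sigma>" using doubling by (auto simp: doubling_weight_def)
  have pos: "0 < \<omega> z" "0 < \<sigma> z" if "z \<in> unit_disk" for z
    using that weights by (auto simp: weight_def)
  have meas [measurable]: "\<omega> \<in> borel_measurable disk_area" "\<sigma> \<in> borel_measurable disk_area"
    using weights by (auto simp: weight_def)
  obtain C\<^sub>1 where C1: "doubling_disk_measure ?\<mu> C\<^sub>1"
    using doubling_weight_disk_measure[OF doubling(1)] .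
  obtain C\<^sub>2 where C2: "doubling_disk_measure ?\<nu> C\<^sub>2"
    using doubling_weight_disk_measure[OF doubling(2)] .
  \<comment> \<open>A box over an arc of length \<open>L \<le> 128 * d\<close> has area at most \<open>(16 * L) ^ 2 \<le> (2048 * d) ^ 2\<close>. The
    factor 128 suffices both for the short arcs, of length at most \<open>16 * d\<close>, and for the whole circle,
    which is used when \<open>d > 1 / 8\<close>.\<close>
  define B where "B = max A 1 * 2048 powr (p * \<alpha>)"
  have B: "0 < B" by (simp add: B_def)
  have box: "measure ?\<mu> (carleson_box I) * measure ?\<nu> (carleson_box I) powr (p - 1) \<le> B * d powr (p * \<alpha>)"
    if I: "I \<in> arcs" and d: "arc_length I \<le> 128 * d" for I d
  proof -
    note L = arc_length_bounds[OF I]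
    have "measure ?\<mu> (carleson_box I) * measure ?\<nu> (carleson_box I) powr (p - 1)
        \<le> A * measure disk_area (carleson_box I) powr (p * \<alpha> / 2)"
      using A[OF I] carleson_box_sets[OF I] weights by (simp add: weighted_area_eq_measure)
    also have "\<dots> \<le> max A 1 * measure disk_area (carleson_box I) powr (p * \<alpha> / 2)"
      by (intro mult_right_mono) auto
    also have "\<dots> \<le> max A 1 * ((2048 * d)\<^sup>2) powr (p * \<alpha> / 2)"
    proof (intro mult_left_mono powr_mono2)
      have "(16 * arc_length I)\<^sup>2 \<le> (2048 * d)\<^sup>2"
        using L d by (intro power_mono) auto
      then show "measure disk_area (carleson_box I) \<le> (2048 * d)\<^sup>2"
        using carleson_box_area(2)[OF I] by linarith
    qed (use \<alpha> pq in auto)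
    also have "((2048 * d)\<^sup>2) powr (p * \<alpha> / 2) = (2048 * d) powr (p * \<alpha>)"
      using L d by (intro power2_powr_half) simp
    finally show ?thesis by (simp add: B_def powr_mult mult_ac)
  qed
  have bound: "measure ?\<mu> (ball z d \<inter> unit_disk) * measure ?\<nu> (ball z d \<inter> unit_disk) powr (p - 1)
      \<le> B * d powr (p * \<alpha>)" if z: "z \<in> unit_disk" and d: "1 - norm z \<le> d" for z d
  proof -
    have "\<exists>I\<in>arcs. ball z d \<inter> unit_disk \<subseteq> insert 0 (carleson_box I) \<and> arc_length I \<le> 128 * d"
    proof (cases "d \<le> 1 / 8")
      case True
      have "0 < d" using z d by simp
      with disk_ball_subset_carleson_box[OF z d True] show ?thesis by (smt (verit) subset_insertI2)
    next
      case False
      have "ball z d \<inter> unit_disk \<subseteq> insert 0 (carleson_box (cis ` UNIV))"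
        using circle_arc(2) by blast
      then show ?thesis using circle_arc(1,3) False by (intro bexI[of _ "cis ` UNIV"]) auto
    qed
    then obtain I where I: "I \<in> arcs" "ball z d \<inter> unit_disk \<subseteq> insert 0 (carleson_box I)" "arc_length I \<le> 128 * d"
      by blast
    have le: "measure (weighted_measure \<eta>) (ball z d \<inter> unit_disk) \<le> measure (weighted_measure \<eta>) (carleson_box I)"
      if \<eta>: "weight \<eta>" for \<eta>
    proof -
      interpret finite_measure "weighted_measure \<eta>" by (rule finite_weighted_measure[OF \<eta>])
      have zero: "{0} \<in> null_sets disk_area"
      proof -
        have "{0 :: complex} \<in> null_sets (lebesgue_on unit_disk)"
          by (simp add: null_sets_restrict_space null_sets_completionI)
        then show ?thesis
          using absolutely_continuousI_density[of "\<lambda>_. ennreal (1 / pi)" "lebesgue_on unit_disk"]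
          unfolding disk_area_def absolutely_continuous_def by auto
      qed
      have Q: "carleson_box I \<in> sets (weighted_measure \<eta>)"
        using carleson_box_sets[OF I(1)] by simp
      have "\<eta> \<in> borel_measurable disk_area" using \<eta> by (auto simp: weight_def)
      then have zero': "{0} \<in> null_sets (weighted_measure \<eta>)"
        using absolutely_continuousI_density[of "\<lambda>z. ennreal (\<eta> z)" disk_area] zero
        unfolding absolutely_continuous_def by auto
      have "measure (weighted_measure \<eta>) (ball z d \<inter> unit_disk) \<le> measure (weighted_measure \<eta>) (carleson_box I \<union> {0})"
        using I(2) by (intro finite_measure_mono sets.Un[OF Q null_setsD2[OF zero']]) auto
      also have "\<dots> = measure (weighted_measure \<eta>) (carleson_box I)"
        by (rule measure_Un_null_set[OF Q zero'])
      finally show ?thesis .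
    qed
    have "measure ?\<mu> (ball z d \<inter> unit_disk) * measure ?\<nu> (ball z d \<inter> unit_disk) powr (p - 1)
        \<le> measure ?\<mu> (carleson_box I) * measure ?\<nu> (carleson_box I) powr (p - 1)"
      using pq by (intro mult_mono powr_mono2 le weights) auto
    also have "\<dots> \<le> B * d powr (p * \<alpha>)"
      by (rule box[OF I(1,3)])
    finally show ?thesis .
  qed
  have dual: "\<omega> z powr (1 / p) * \<sigma> z powr (1 / p') = 1" if "z \<in> unit_disk" for z
  proof -
    have "\<omega> z powr (1 / p) * \<sigma> z powr (1 / p') = \<omega> z powr (1 / p + (1 - p') * (1 / p'))"
      by (simp add: \<sigma> dual_weight_def powr_powr powr_add)
    also have "1 / p + (1 - p') * (1 / p') = 0"
    proof -
      have "p' * (1 / p') = 1" using pq by simp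
      then show ?thesis
        using left_diff_distrib[of 1 p' "1 / p'"] pq(3) by linarith
    qed
    finally show ?thesis using pos(1)[OF that] by simp
  qed
  obtain N where N: "0 < N" "\<And>f x. f \<in> borel_measurable disk_area \<Longrightarrow>
    (\<And>z. z \<in> unit_disk \<Longrightarrow> 0 \<le> x z \<and>
      ennreal (x z) \<le> (\<integral>\<^sup>+w. ennreal (norm (f w) * norm (1 - z * cnj w) powr - \<alpha>) \<partial>disk_area)) \<Longrightarrow>
    (\<integral>\<^sup>+z. ennreal (x z powr p * \<omega> z) \<partial>disk_area)
      \<le> ennreal N * (\<integral>\<^sup>+w. ennreal (norm (f w :: complex) powr p * \<omega> w) \<partial>disk_area)"
    by (rule weighted_schur_test[OF pq meas pos dual C1 C2 B bound]) auto
  show ?thesis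
    unfolding bounded_on_Lp_def
  proof (intro exI ballI)
    fix f assume f: "f \<in> Lp p \<omega>"
    have f_meas: "f \<in> borel_measurable disk_area"
      and f_int: "integrable disk_area (\<lambda>z. norm (f z) powr p * \<omega> z)"
      using f by (auto simp: Lp_def)
    let ?X = "LINT z|disk_area. norm (f z) powr p * \<omega> z"
    have nonneg: "AE z in disk_area. 0 \<le> norm (g z) powr p * \<omega> z" for g :: "complex \<Rightarrow> complex"
      by (rule AE_I2) (auto intro!: mult_nonneg_nonneg less_imp_le[OF pos(1)])
    have X: "0 \<le> ?X" by (rule integral_nonneg_AE[OF nonneg])
    have [measurable]: "K_op \<alpha> f \<in> borel_measurable disk_area"
      by (rule borel_measurable_K_op[OF \<alpha> f_meas])
    have "(\<integral>\<^sup>+z. ennreal (norm (K_op \<alpha> f z) powr p * \<omega> z) \<partial>disk_area)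
        \<le> ennreal N * (\<integral>\<^sup>+w. ennreal (norm (f w) powr p * \<omega> w) \<partial>disk_area)"
      by (rule N(2)[OF f_meas]) (simp add: norm_K_op_le)
    also have "\<dots> = ennreal (N * ?X)"
      using nn_integral_eq_integral[OF f_int nonneg] N(1) X by (simp add: ennreal_mult)
    finally have Kf: "(\<integral>\<^sup>+z. ennreal (norm (K_op \<alpha> f z) powr p * \<omega> z) \<partial>disk_area) \<le> ennreal (N * ?X)" .
    have int: "integrable disk_area (\<lambda>z. norm (K_op \<alpha> f z) powr p * \<omega> z)"
      using le_less_trans[OF Kf] by (intro integrableI_nonneg nonneg) auto
    have "ennreal (LINT z|disk_area. norm (K_op \<alpha> f z) powr p * \<omega> z) \<le> ennreal (N * ?X)"
      using Kf by (simp add: nn_integral_eq_integral[OF int nonneg])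
    then have le: "(LINT z|disk_area. norm (K_op \<alpha> f z) powr p * \<omega> z) \<le> N * ?X"
      using N(1) X by (simp add: ennreal_le_iff)
    show "K_op \<alpha> f \<in> Lp p \<omega> \<and> Lp_norm p \<omega> (K_op \<alpha> f) \<le> N powr (1 / p) * Lp_norm p \<omega> f"
    proof
      show "K_op \<alpha> f \<in> Lp p \<omega>" using int by (simp add: Lp_def)
      have "Lp_norm p \<omega> (K_op \<alpha> f) \<le> (N * ?X) powr (1 / p)"
        unfolding Lp_norm_def using le pq by (intro powr_mono2 integral_nonneg_AE nonneg) auto
      then show "Lp_norm p \<omega> (K_op \<alpha> f) \<le> N powr (1 / p) * Lp_norm p \<omega> f"
        by (simp add: Lp_norm_def powr_mult)
    qed
  qed
qed

section \<open>From boundedness to Carleson boxes\<close>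

lemma inverse_powr_near_one:
  fixes \<alpha> :: real
  obtains \<epsilon> :: real where "0 < \<epsilon>" "\<epsilon> \<le> 1 / 4"
    "\<And>u :: complex. norm (u - 1) \<le> 2 * \<epsilon> \<Longrightarrow> 1 / 2 \<le> Re (1 / u powr of_real \<alpha>)"
proof -
  let ?g = "\<lambda>u :: complex. 1 / u powr of_real \<alpha>"
  have "isCont ?g 1"
    by (intro continuous_intros) auto
  then obtain d where d: "0 < d" "\<And>u. dist u 1 < d \<Longrightarrow> dist (?g u) (?g 1) < 1 / 2"
    unfolding continuous_at_eps_delta by (metis zero_less_divide_1_iff zero_less_numeral)
  show thesis
  proof (rule that[of "min (d / 4) (1 / 4)"])
    fix u :: complex assume "norm (u - 1) \<le> 2 * min (d / 4) (1 / 4)"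
    then have "dist u 1 < d" using d(1) by (simp add: dist_norm)
    then have "norm (?g u - 1) < 1 / 2" using d(2) by (simp add: dist_norm)
    then show "1 / 2 \<le> Re (?g u)"
      using abs_Re_le_cmod[of "?g u - 1"] unfolding minus_complex.sel one_complex.sel by linarith
  qed (use d in auto)
qed

lemma powr_of_real_mult:
  fixes a \<alpha> :: real and u :: complex
  assumes "0 < a" "u \<noteq> 0"
  shows "(of_real a * u) powr of_real \<alpha> = of_real (a powr \<alpha>) * u powr of_real \<alpha>"
proof -
  have "of_real a * u \<noteq> 0" using assms by simp
  then have "(of_real a * u) powr of_real \<alpha> = exp (of_real \<alpha> * Ln (of_real a * u))"
    by (simp only: powr_def if_False)
  also have "\<dots> = exp (of_real (\<alpha> * ln a) + of_real \<alpha> * Ln u)"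
    unfolding Ln_times_of_real[OF assms] Ln_of_real[OF assms(1)] by (simp only: distrib_left of_real_mult)
  also have "\<dots> = of_real (exp (\<alpha> * ln a)) * exp (of_real \<alpha> * Ln u)"
    by (simp only: exp_add exp_of_real)
  finally show ?thesis
    using assms by (simp add: powr_def)
qed

text \<open>For \<open>z\<close> and \<open>w\<close> within \<open>\<epsilon> * (1 - norm c)\<close> of \<open>c\<close>, the number \<open>1 - z * cnj w\<close> is
\<open>a = 1 - norm c ^ 2\<close> times a factor within \<open>2 * \<epsilon>\<close> of 1. The power of \<open>a\<close> is real and can be taken
out of the principal branch, and what remains has real part at least \<open>1 / 2\<close>.\<close>

lemma kernel_lower_bound_small_ball:
  fixes \<alpha> \<epsilon> :: real and c z w :: complex
  assumes \<alpha>: "0 < \<alpha>" and \<epsilon>: "0 < \<epsilon>" "\<epsilon> \<le> 1 / 4"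
      "\<And>u :: complex. norm (u - 1) \<le> 2 * \<epsilon> \<Longrightarrow> 1 / 2 \<le> Re (1 / u powr of_real \<alpha>)"
    and c: "norm c < 1" and zw: "z \<in> ball c (\<epsilon> * (1 - norm c))" "w \<in> ball c (\<epsilon> * (1 - norm c))"
    and disk: "norm z < 1" "norm w < 1"
  shows "(2 * (1 - norm c)) powr - \<alpha> / 2 \<le> Re (1 / (1 - z * cnj w) powr of_real \<alpha>)"
proof -
  define a where "a = 1 - (norm c)\<^sup>2"
  have a_eq: "a = (1 - norm c) * (1 + norm c)"
    by (simp add: a_def power2_eq_square algebra_simps)
  have a: "1 - norm c \<le> a" "a \<le> 2 * (1 - norm c)"
  proof -
    have "(1 - norm c) * 1 \<le> (1 - norm c) * (1 + norm c)" using c by (intro mult_left_mono) auto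
    then show "1 - norm c \<le> a" by (simp add: a_eq)
    have "(1 - norm c) * (1 + norm c) \<le> (1 - norm c) * 2" using c by (intro mult_left_mono) auto
    then show "a \<le> 2 * (1 - norm c)" by (simp add: a_eq)
  qed
  have a_pos: "0 < a" using a c by linarith
  define u where "u = (1 - z * cnj w) / of_real a"
  have zw_eq: "1 - z * cnj w = of_real a * u" using a_pos by (simp add: u_def)
  have "1 - z * cnj w - of_real a = c * cnj (c - w) + (c - z) * cnj w"
    unfolding a_def of_real_diff complex_norm_square by (simp add: algebra_simps)
  then have "norm (1 - z * cnj w - of_real a) \<le> norm (c * cnj (c - w)) + norm ((c - z) * cnj w)"
    by (simp only: norm_triangle_ineq)
  also have "\<dots> = norm c * norm (c - w) + norm (c - z) * norm w"
    by (simp only: norm_mult complex_mod_cnj)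
  also have "\<dots> \<le> norm (c - w) + norm (c - z)"
    using c disk by (intro add_mono) (simp_all add: mult_left_le_one_le mult_right_le_one_le)
  also have "\<dots> \<le> 2 * \<epsilon> * (1 - norm c)"
    using zw by (simp add: dist_norm)
  also have "\<dots> \<le> 2 * \<epsilon> * a"
    using a \<epsilon> by (intro mult_left_mono) auto
  finally have "norm (1 - z * cnj w - of_real a) \<le> 2 * \<epsilon> * a" .
  moreover have "u - 1 = (1 - z * cnj w - of_real a) / of_real a"
    using a_pos by (simp add: u_def diff_divide_distrib)
  ultimately have "norm (u - 1) \<le> 2 * \<epsilon>"
    using a_pos by (simp add: norm_divide pos_divide_le_eq)
  then have half: "1 / 2 \<le> Re (1 / u powr of_real \<alpha>)" by (rule \<epsilon>)
  have u0: "u \<noteq> 0"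
    using one_minus_mult_cnj_bounds(5)[OF disk] zw_eq by auto
  have "1 / (1 - z * cnj w) powr of_real \<alpha> = of_real (a powr - \<alpha>) * (1 / u powr of_real \<alpha>)"
    unfolding zw_eq powr_of_real_mult[OF a_pos u0] by (simp add: powr_minus_divide)
  then have "Re (1 / (1 - z * cnj w) powr of_real \<alpha>) = a powr - \<alpha> * Re (1 / u powr of_real \<alpha>)"
    by (simp only: Re_complex_of_real Im_complex_of_real times_complex.sel)
  moreover have "(2 * (1 - norm c)) powr - \<alpha> \<le> a powr - \<alpha>"
    using a a_pos \<alpha> by (intro powr_mono2') auto
  moreover have "a powr - \<alpha> * (1 / 2) \<le> a powr - \<alpha> * Re (1 / u powr of_real \<alpha>)"
    by (intro mult_left_mono half) simp
  ultimately show ?thesis by linarith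
qed

lemma dual_weight_power_identity:
  assumes pq: "p > 1" "p' > 1" "1 / p + 1 / p' = 1" and "0 < \<omega> z"
  shows "dual_weight p' \<omega> z powr p * \<omega> z = dual_weight p' \<omega> z"
proof -
  have "p + p' = p * p'" using pq by (simp add: field_simps)
  then have e: "(1 - p') * p + 1 = 1 - p'" by (simp add: algebra_simps)
  have "dual_weight p' \<omega> z powr p * \<omega> z = \<omega> z powr ((1 - p') * p) * \<omega> z powr 1"
    using assms by (simp add: dual_weight_def powr_powr)
  also have "\<dots> = \<omega> z powr (1 - p')" unfolding powr_add[symmetric] e ..
  finally show ?thesis by (simp add: dual_weight_def)
qed

text \<open>The test function is \<open>\<sigma>\<close> on the small disk \<open>B\<close>. Since \<open>\<sigma> powr p * \<omega> = \<sigma>\<close>, its norm is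
\<open>\<sigma>(B) powr (1 / p)\<close>, while its image is at least a constant times
\<open>\<sigma>(B) * (1 - norm \<zeta>) powr - \<alpha>\<close> on \<open>B\<close>; comparing the two norms gives the claim.\<close>

lemma small_ball_necessary:
  fixes \<alpha> p p' c \<epsilon> :: real and \<omega> \<sigma> :: "complex \<Rightarrow> real" and \<zeta> :: complex
  assumes \<alpha>: "\<alpha> > 0" and pq: "p > 1" "p' > 1" "1 / p + 1 / p' = 1"
    and \<sigma>: "\<sigma> = dual_weight p' \<omega>"
    and weights: "weight \<omega>" "weight \<sigma>"
    and bounded: "\<And>f. f \<in> Lp p \<omega> \<Longrightarrow> K_op \<alpha> f \<in> Lp p \<omega> \<and> Lp_norm p \<omega> (K_op \<alpha> f) \<le> c * Lp_norm p \<omega> f"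
    and c: "0 < c"
    and \<epsilon>: "0 < \<epsilon>" "\<epsilon> \<le> 1 / 4"
      "\<And>u :: complex. norm (u - 1) \<le> 2 * \<epsilon> \<Longrightarrow> 1 / 2 \<le> Re (1 / u powr of_real \<alpha>)"
    and \<zeta>: "\<zeta> \<in> unit_disk"
  defines "B \<equiv> ball \<zeta> (\<epsilon> * (1 - norm \<zeta>)) \<inter> unit_disk"
  shows "measure (weighted_measure \<omega>) B * measure (weighted_measure \<sigma>) B powr (p - 1)
      \<le> (2 * c) powr p * (2 * (1 - norm \<zeta>)) powr (p * \<alpha>)"
proof -
  have pos: "0 < \<omega> z" "0 < \<sigma> z" if "z \<in> unit_disk" for z
    using that weights by (auto simp: weight_def)
  have meas [measurable]: "\<omega> \<in> borel_measurable disk_area" "\<sigma> \<in> borel_measurable disk_area"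
    and \<sigma>_int: "integrable disk_area \<sigma>" and \<omega>_int: "integrable disk_area \<omega>"
    using weights by (auto simp: weight_def)
  have B [measurable]: "B \<in> sets disk_area" unfolding B_def by (rule disk_ball_sets)
  define \<delta> where "\<delta> = 1 - norm \<zeta>"
  have \<delta>: "0 < \<delta>" using \<zeta> by (simp add: \<delta>_def)
  define s where "s = measure (weighted_measure \<sigma>) B"
  define m where "m = measure (weighted_measure \<omega>) B"
  have s: "0 < s" and m: "0 < m"
    unfolding s_def m_def B_def using \<zeta> \<epsilon> \<delta> weights by (auto intro!: weighted_measure_ball_pos simp: \<delta>_def)
  have s_eq: "s = (LINT z|disk_area. indicator B z * \<sigma> z)"
    and m_eq: "m = (LINT z|disk_area. indicator B z * \<omega> z)"
    unfolding s_def m_def weighted_area_eq_measure[OF weights(1) B, symmetric]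
      weighted_area_eq_measure[OF weights(2) B, symmetric] weighted_area_def set_lebesgue_integral_def
    by simp_all
  have B\<sigma>_int: "integrable disk_area (\<lambda>z. indicator B z * \<sigma> z)"
    and B\<omega>_int: "integrable disk_area (\<lambda>z. indicator B z * \<omega> z)"
    using integrable_mult_indicator[OF B \<sigma>_int] integrable_mult_indicator[OF B \<omega>_int] by simp_all
  define f where "f z = complex_of_real (indicator B z * \<sigma> z)" for z
  have f_meas: "f \<in> borel_measurable disk_area" unfolding f_def by measurable
  have f_pow: "norm (f z) powr p * \<omega> z = indicator B z * \<sigma> z" if "z \<in> space disk_area" for z
  proof (cases "z \<in> B")
    case True
    have "norm (f z) = \<sigma> z" using True that pos(2)[of z] by (simp add: f_def)
    then show ?thesis
      using True that pos(1)[of z] dual_weight_power_identity[OF pq, of \<omega> z] by (simp add: \<sigma>)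
  qed (simp add: f_def)
  have "integrable disk_area (\<lambda>z. norm (f z) powr p * \<omega> z)"
    using B\<sigma>_int by (subst Bochner_Integration.integrable_cong[OF refl f_pow])
  then have f_Lp: "f \<in> Lp p \<omega>" using f_meas by (simp add: Lp_def)
  have f_norm: "Lp_norm p \<omega> f = s powr (1 / p)"
    unfolding Lp_norm_def s_eq by (subst Bochner_Integration.integral_cong[OF refl f_pow]) auto
  define k where "k = (2 * \<delta>) powr - \<alpha> / 2"
  have k: "0 < k" using \<delta> by (simp add: k_def)
  have Kf: "s * k \<le> norm (K_op \<alpha> f z)" if z: "z \<in> B" for z
  proof -
    have z1: "norm z < 1" using z by (simp add: B_def)
    then have "z \<in> unit_disk" by simp
    note [measurable] = borel_measurable_kernel[OF \<alpha> this] f_meas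
    have [measurable]: "(\<lambda>w. f w / (1 - z * cnj w) powr of_real \<alpha>) \<in> borel_measurable disk_area"
      by measurable
    have int: "integrable disk_area (\<lambda>w. f w / (1 - z * cnj w) powr of_real \<alpha>)"
    proof (rule Bochner_Integration.integrable_bound)
      show "integrable disk_area (\<lambda>w. (1 - norm z) powr - \<alpha> * (indicator B w * \<sigma> w))"
        using B\<sigma>_int by (rule integrable_mult_right)
      show "AE w in disk_area. norm (f w / (1 - z * cnj w) powr of_real \<alpha>)
          \<le> norm ((1 - norm z) powr - \<alpha> * (indicator B w * \<sigma> w))"
      proof (rule AE_I2)
        fix w assume "w \<in> space disk_area"
        then have w: "norm w < 1" by simp
        have "norm (1 - z * cnj w) powr - \<alpha> \<le> (1 - norm z) powr - \<alpha>"
          using one_minus_mult_cnj_bounds(2)[OF z1 w] \<alpha> z1 by (intro powr_mono2') auto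
        then have "norm (f w) * norm (1 - z * cnj w) powr - \<alpha> \<le> norm (f w) * (1 - norm z) powr - \<alpha>"
          by (rule mult_left_mono) simp
        moreover have "norm (f w / (1 - z * cnj w) powr of_real \<alpha>) = norm (f w) * norm (1 - z * cnj w) powr - \<alpha>"
          by (simp add: norm_divide norm_powr_real_powr' powr_minus_divide)
        moreover have "norm ((1 - norm z) powr - \<alpha> * (indicator B w * \<sigma> w)) = norm (f w) * (1 - norm z) powr - \<alpha>"
          by (simp add: f_def abs_mult norm_mult)
        ultimately show "norm (f w / (1 - z * cnj w) powr of_real \<alpha>)
          \<le> norm ((1 - norm z) powr - \<alpha> * (indicator B w * \<sigma> w))" by simp
      qed
    qed measurable
    have "s * k = (LINT w|disk_area. indicator B w * \<sigma> w * k)"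
      by (simp add: s_eq)
    also have "\<dots> \<le> (LINT w|disk_area. Re (f w / (1 - z * cnj w) powr of_real \<alpha>))"
    proof (rule integral_mono)
      show "integrable disk_area (\<lambda>w. indicator B w * \<sigma> w * k)"
        using B\<sigma>_int by (rule integrable_mult_left)
      show "integrable disk_area (\<lambda>w. Re (f w / (1 - z * cnj w) powr of_real \<alpha>))"
        using int by (rule integrable_Re)
      fix w assume w: "w \<in> space disk_area"
      show "indicator B w * \<sigma> w * k \<le> Re (f w / (1 - z * cnj w) powr of_real \<alpha>)"
      proof (cases "w \<in> B")
        case True
        have "k \<le> Re (1 / (1 - z * cnj w) powr of_real \<alpha>)"
          unfolding k_def \<delta>_def using True z \<zeta> w
          by (intro kernel_lower_bound_small_ball[OF \<alpha> \<epsilon>]) (auto simp: B_def)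
        then have "\<sigma> w * k \<le> \<sigma> w * Re (1 / (1 - z * cnj w) powr of_real \<alpha>)"
          using pos(2)[of w] w by (intro mult_left_mono) auto
        also have "\<dots> = Re (of_real (\<sigma> w) * (1 / (1 - z * cnj w) powr of_real \<alpha>))"
          by (simp only: Re_complex_of_real Im_complex_of_real times_complex.sel)
        finally show ?thesis using True by (simp add: f_def)
      qed (simp add: f_def)
    qed
    also have "\<dots> = Re (K_op \<alpha> f z)"
      unfolding K_op_def using int by (rule integral_Re)
    also have "\<dots> \<le> norm (K_op \<alpha> f z)" by (rule complex_Re_le_cmod)
    finally show ?thesis .
  qed
  let ?Y = "LINT z|disk_area. norm (K_op \<alpha> f z) powr p * \<omega> z"
  have K_int: "integrable disk_area (\<lambda>z. norm (K_op \<alpha> f z) powr p * \<omega> z)"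
    and K_norm: "?Y powr (1 / p) \<le> c * s powr (1 / p)"
    using bounded[OF f_Lp] f_norm by (auto simp: Lp_def Lp_norm_def)
  have "(s * k) powr p * m = (LINT z|disk_area. (s * k) powr p * (indicator B z * \<omega> z))"
    by (simp add: m_eq)
  also have "\<dots> \<le> ?Y"
  proof (rule integral_mono[OF _ K_int])
    show "integrable disk_area (\<lambda>z. (s * k) powr p * (indicator B z * \<omega> z))"
      using B\<omega>_int by (rule integrable_mult_right)
    fix z assume z: "z \<in> space disk_area"
    show "(s * k) powr p * (indicator B z * \<omega> z) \<le> norm (K_op \<alpha> f z) powr p * \<omega> z"
    proof (cases "z \<in> B")
      case True
      have "(s * k) powr p \<le> norm (K_op \<alpha> f z) powr p"
        using Kf[OF True] s k pq by (intro powr_mono2) auto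
      then show ?thesis
        using True pos(1)[of z] z by simp
    next
      case False
      then show ?thesis using pos(1)[of z] z by simp
    qed
  qed
  finally have le: "(s * k) powr p * m \<le> ?Y" .
  have Y: "0 \<le> ?Y"
    using le s k m by (smt (verit) mult_nonneg_nonneg powr_ge_zero)
  have "?Y = (?Y powr (1 / p)) powr p"
    using Y pq by (simp add: powr_powr)
  also have "\<dots> \<le> (c * s powr (1 / p)) powr p"
    using K_norm pq by (intro powr_mono2) auto
  also have "\<dots> = c powr p * s"
    using s pq by (simp add: powr_mult powr_powr)
  finally have "(s * k) powr p * m \<le> c powr p * s" using le by linarith
  then have "s powr (p - 1) * s * k powr p * m \<le> c powr p * s"
    using s by (simp add: powr_mult powr_diff)
  then have "m * s powr (p - 1) * k powr p \<le> c powr p"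
    using s by (simp add: mult_ac)
  then have "m * s powr (p - 1) \<le> c powr p / k powr p"
    using k by (simp add: pos_le_divide_eq)
  also have "c powr p / k powr p = (2 * c) powr p * (2 * \<delta>) powr (p * \<alpha>)"
    by (simp add: k_def powr_divide powr_mult powr_powr powr_minus mult.commute divide_simps)
  finally show ?thesis by (simp add: s_def m_def \<delta>_def)
qed

text \<open>A box over an arc of length \<open>L\<close> lies in a disk of radius \<open>16 * L\<close> about a point \<open>\<zeta>\<close> of depth
\<open>L / 2\<close>, and a fixed number of doublings compares this disk with the small disk about \<open>\<zeta>\<close>.\<close>

lemma carleson_box_necessary:
  fixes \<alpha> p p' :: real and \<omega> \<sigma> :: "complex \<Rightarrow> real"
  assumes \<alpha>: "\<alpha> > 0" and pq: "p > 1" "p' > 1" "1 / p + 1 / p' = 1"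
    and \<sigma>: "\<sigma> = dual_weight p' \<omega>"
    and doubling: "doubling_weight \<omega>" "doubling_weight \<sigma>"
    and bounded: "bounded_on_Lp p \<omega> (K_op \<alpha>)"
  obtains A where "\<And>I. I \<in> arcs \<Longrightarrow>
      weighted_area \<omega> (carleson_box I) * weighted_area \<sigma> (carleson_box I) powr (p - 1)
      \<le> A * measure disk_area (carleson_box I) powr (p * \<alpha> / 2)"
proof -
  let ?\<mu> = "weighted_measure \<omega>" and ?\<nu> = "weighted_measure \<sigma>"
  have weights: "weight \<omega>" "weight \<sigma>" using doubling by (auto simp: doubling_weight_def)
  obtain C\<^sub>1 where C1: "doubling_disk_measure ?\<mu> C\<^sub>1"
    using doubling_weight_disk_measure[OF doubling(1)] .
  obtain C\<^sub>2 where C2: "doubling_disk_measure ?\<nu> C\<^sub>2"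
    using doubling_weight_disk_measure[OF doubling(2)] .
  interpret \<mu>: doubling_disk_measure ?\<mu> C\<^sub>1 by (rule C1)
  interpret \<nu>: doubling_disk_measure ?\<nu> C\<^sub>2 by (rule C2)
  obtain c\<^sub>0 where c0: "\<And>f. f \<in> Lp p \<omega> \<Longrightarrow> K_op \<alpha> f \<in> Lp p \<omega> \<and> Lp_norm p \<omega> (K_op \<alpha> f) \<le> c\<^sub>0 * Lp_norm p \<omega> f"
    using bounded by (auto simp: bounded_on_Lp_def)
  define c where "c = max 1 c\<^sub>0"
  have c: "0 < c" by (simp add: c_def)
  have bd: "K_op \<alpha> f \<in> Lp p \<omega> \<and> Lp_norm p \<omega> (K_op \<alpha> f) \<le> c * Lp_norm p \<omega> f" if "f \<in> Lp p \<omega>" for f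
  proof -
    have "0 \<le> Lp_norm p \<omega> f" by (simp add: Lp_norm_def)
    then have "c\<^sub>0 * Lp_norm p \<omega> f \<le> c * Lp_norm p \<omega> f"
      by (intro mult_right_mono) (auto simp: c_def)
    then show ?thesis using c0[OF that] by linarith
  qed
  obtain \<epsilon> where \<epsilon>: "0 < \<epsilon>" "\<epsilon> \<le> 1 / 4"
    "\<And>u :: complex. norm (u - 1) \<le> 2 * \<epsilon> \<Longrightarrow> 1 / 2 \<le> Re (1 / u powr of_real \<alpha>)"
    using inverse_powr_near_one[of \<alpha>] by blast
  \<comment> \<open>\<open>n\<close> doublings lead from the radius \<open>\<epsilon> * L / 2\<close> to \<open>16 * L\<close>.\<close>
  obtain n :: nat where n: "32 / \<epsilon> < 2 ^ n"
    using real_arch_pow[of 2 "32 / \<epsilon>"] by auto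
  \<comment> \<open>The last factor comes from rewriting \<open>L powr (p * \<alpha>)\<close> in terms of the radius \<open>L / 16\<close> of a ball
    contained in the box.\<close>
  define A where "A = C\<^sub>1 ^ n * (C\<^sub>2 ^ n) powr (p - 1) * (2 * c) powr p * 16 powr (p * \<alpha>)"
  show thesis
  proof (rule that[of A])
    fix I assume I: "I \<in> arcs"
    define L where "L = arc_length I"
    note L = arc_length_bounds[OF I, folded L_def]
    have area: "(L / 16)\<^sup>2 \<le> measure disk_area (carleson_box I)"
      unfolding L_def by (rule carleson_box_area[OF I])
    then have "carleson_box I \<noteq> {}"
      using L by (auto simp: zero_less_power not_le)
    then obtain u where u: "u \<in> I" by (auto simp: carleson_box_def)
    then have nu: "norm u = 1" using I by (auto simp: arcs_def)
    define \<zeta> where "\<zeta> = of_real (1 - L / 2) * u"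
    have n\<zeta>: "norm \<zeta> = 1 - L / 2" unfolding \<zeta>_def norm_mult norm_of_real nu using L by simp
    have \<zeta>: "\<zeta> \<in> unit_disk" using n\<zeta> L by simp
    define B where "B = ball \<zeta> (\<epsilon> * (1 - norm \<zeta>)) \<inter> unit_disk"
    have "32 \<le> 2 ^ n * \<epsilon>" using n \<epsilon>(1) by (simp add: pos_divide_less_eq less_imp_le)
    then have radius: "16 * L \<le> 2 ^ n * (\<epsilon> * (1 - norm \<zeta>))"
      using mult_right_mono[of 32 "2 ^ n * \<epsilon>" "L / 2"] L unfolding n\<zeta> by (simp add: mult.assoc)
    have sub: "carleson_box I \<subseteq> ball \<zeta> (16 * L) \<inter> unit_disk"
      using carleson_box_subset_ball[OF I u] by (auto simp: \<zeta>_def L_def carleson_box_def)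
    have r: "0 < \<epsilon> * (1 - norm \<zeta>)" using \<epsilon>(1) n\<zeta> L by simp
    have \<mu>: "weighted_area \<omega> (carleson_box I) \<le> C\<^sub>1 ^ n * measure ?\<mu> B"
    proof -
      have "weighted_area \<omega> (carleson_box I) \<le> \<mu>.mass \<zeta> (16 * L)"
        unfolding weighted_area_eq_measure[OF weights(1) carleson_box_sets[OF I]] \<mu>.mass_def
        by (rule \<mu>.finite_measure_mono[OF sub \<mu>.ball_sets])
      also have "\<dots> \<le> C\<^sub>1 ^ n * \<mu>.mass \<zeta> (\<epsilon> * (1 - norm \<zeta>))"
        using \<zeta> r radius by (intro \<mu>.mass_compare) auto
      finally show ?thesis by (simp add: \<mu>.mass_def B_def)
    qed
    have \<nu>: "weighted_area \<sigma> (carleson_box I) \<le> C\<^sub>2 ^ n * measure ?\<nu> B"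
    proof -
      have "weighted_area \<sigma> (carleson_box I) \<le> \<nu>.mass \<zeta> (16 * L)"
        unfolding weighted_area_eq_measure[OF weights(2) carleson_box_sets[OF I]] \<nu>.mass_def
        by (rule \<nu>.finite_measure_mono[OF sub \<nu>.ball_sets])
      also have "\<dots> \<le> C\<^sub>2 ^ n * \<nu>.mass \<zeta> (\<epsilon> * (1 - norm \<zeta>))"
        using \<zeta> r radius by (intro \<nu>.mass_compare) auto
      finally show ?thesis by (simp add: \<nu>.mass_def B_def)
    qed
    have nonneg: "0 \<le> weighted_area \<omega> (carleson_box I)" "0 \<le> weighted_area \<sigma> (carleson_box I)"
      using weights carleson_box_sets[OF I] by (simp_all add: weighted_area_eq_measure)
    have C: "0 \<le> C\<^sub>1 ^ n" "0 \<le> C\<^sub>2 ^ n" using \<mu>.C_ge_1 \<nu>.C_ge_1 by simp_all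
    have "weighted_area \<omega> (carleson_box I) * weighted_area \<sigma> (carleson_box I) powr (p - 1)
        \<le> (C\<^sub>1 ^ n * measure ?\<mu> B) * (C\<^sub>2 ^ n * measure ?\<nu> B) powr (p - 1)"
      using \<mu> \<nu> nonneg C pq by (intro mult_mono powr_mono2) auto
    also have "\<dots> = C\<^sub>1 ^ n * (C\<^sub>2 ^ n) powr (p - 1) * (measure ?\<mu> B * measure ?\<nu> B powr (p - 1))"
      by (simp add: powr_mult mult_ac)
    also have "\<dots> \<le> C\<^sub>1 ^ n * (C\<^sub>2 ^ n) powr (p - 1) * ((2 * c) powr p * (2 * (1 - norm \<zeta>)) powr (p * \<alpha>))"
      unfolding B_def using C
      by (intro mult_left_mono small_ball_necessary[OF \<alpha> pq \<sigma> weights bd c \<epsilon> \<zeta>]) auto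
    also have "2 * (1 - norm \<zeta>) = 16 * (L / 16)" by (simp add: n\<zeta>)
    also have "C\<^sub>1 ^ n * (C\<^sub>2 ^ n) powr (p - 1) * ((2 * c) powr p * (16 * (L / 16)) powr (p * \<alpha>))
        = A * (L / 16) powr (p * \<alpha>)"
      unfolding A_def powr_mult[of 16 "L / 16"] by (simp only: mult.assoc)
    also have "(L / 16) powr (p * \<alpha>) = ((L / 16)\<^sup>2) powr (p * \<alpha> / 2)"
      using L by (intro power2_powr_half[symmetric]) simp
    also have "A * ((L / 16)\<^sup>2) powr (p * \<alpha> / 2) \<le> A * measure disk_area (carleson_box I) powr (p * \<alpha> / 2)"
      using area \<alpha> pq C by (intro mult_left_mono powr_mono2) (auto simp: A_def)
    finally show "weighted_area \<omega> (carleson_box I) * weighted_area \<sigma> (carleson_box I) powr (p - 1)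
      \<le> A * measure disk_area (carleson_box I) powr (p * \<alpha> / 2)" .
  qed
qed

theorem theorem1p1:
  fixes \<alpha> p p' :: real and \<omega> \<sigma> :: "complex \<Rightarrow> real"
  assumes "\<alpha> > 0"
    and "p > 1" and "p' > 1" and "1 / p + 1 / p' = 1"
    and "weight \<omega>"
    and "\<sigma> = dual_weight p' \<omega>"
    and "doubling_weight \<omega>" and "doubling_weight \<sigma>"
  shows "bounded_on_Lp p \<omega> (K_op \<alpha>) \<longleftrightarrow> carleson_characteristic p \<alpha> \<omega> \<sigma> < \<infinity>"
proof
  assume "bounded_on_Lp p \<omega> (K_op \<alpha>)"
  then show "carleson_characteristic p \<alpha> \<omega> \<sigma> < \<infinity>"
    unfolding carleson_characteristic_finite_iff
    using carleson_box_necessary[OF assms(1-4,6-8)] by metis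
next
  assume "carleson_characteristic p \<alpha> \<omega> \<sigma> < \<infinity>"
  then show "bounded_on_Lp p \<omega> (K_op \<alpha>)"
    unfolding carleson_characteristic_finite_iff
    using carleson_box_sufficient[OF assms(1-4,6-8)] by blast
qed

end
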